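(* Let $(M,E)$ be a Finsler manifold and let $T^{\star}$ be the classical torsion of its Hashiguchi connection $D^{\star}$. Then for all $\zeta,\xi\in\mathfrak{X}(TM)$: (a) the (h)h-torsion is $T^{\star}(h\zeta,h\xi)=\mathfrak{R}(\zeta,\xi)$; (b) the (h)v-torsion is $T^{\star}(h\zeta,J\xi)=-F\mathcal{C}(\zeta,\xi)$.
   Context: Setting. $M$ is an $n$-dimensional smooth manifold, $\mathcal{T}M=TM\setminus\{0\}$, and all objects "on $TM$" below (vector fields $\mathfrak{X}(TM)$, linear connections on $TM$, i.e. covariant derivatives of vector fields on $TM$) are considered over $\mathcal{T}M$, where they are smooth. In induced coordinates $(x^i,y^i)$, $J=\frac{\partial}{\partial y^i}\otimes dx^i$ is the almost tangent structure (so $\mathrm{Im}\,J=\ker J=V(TM)$, the vertical bundle) and $C=y^i\frac{\partial}{\partial y^i}$ is the Liouville vector field. A Finsler manifold $(M,E)$ is $M$ with $E:TM\to\mathbb{R}$ such that $E>0$ on $\mathcal{T}M$, $E(0)=0$, $E$ is smooth on $\mathcal{T}M$ and $C^1$ on $TM$, $\mathcal{L}_CE=2E$ (positively homogeneous of degree 2), and $\Omega:=dd_JE$ has maximal rank, where $d_JE(\zeta)=dE(J\zeta)$. The canonical spray $S$ is the unique vector field with $i_S\Omega=-dE$ ($JS=C$, $[C,S]=S$). The Barthel connection is $\Gamma=[J,S]$, i.e. $\Gamma\zeta=[J\zeta,S]-J[\zeta,S]$, with projectors $h=\frac12(I+\Gamma)$, $v=\frac12(I-\Gamma)$; the associated almost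 complex structure $F$ is defined by $FJ=h$, $Fh=-J$. The curvature of $\Gamma$ is $\mathfrak{R}=-\frac12[h,h]$ (Frölicher–Nijenhuis bracket), i.e. $\mathfrak{R}(\zeta,\eta)=-\big([h\zeta,h\eta]+h[\zeta,\eta]-h[h\zeta,\eta]-h[\zeta,h\eta]\big)$. The metric $g$ on $T(TM)$ is $g(\zeta,\xi)=\overline g(J\zeta,J\xi)+\overline g(v\zeta,v\xi)$ with $\overline g(J\zeta,J\xi)=\Omega(J\zeta,\xi)$. The first Cartan tensor $\mathcal{C}$ is the vertical-vector-valued tensor ($J\mathcal{C}=0$) defined by $\Omega(\mathcal{C}(\zeta,\eta),\xi)=\frac12(\mathcal{L}_{J\zeta}(J^{*}g))(\eta,\xi)$, with $(J^{*}g)(\eta,\xi)=g(J\eta,J\xi)$; it is symmetric and semi-basic (vanishes if an argument is vertical), and $\mathcal{C}(\eta,S)=0$. Hashiguchi connection $D^{\star}$: the unique linear connection on $TM$ that is a lift of $\Gamma$ (that is, $D^{\star}J=0$, $D^{\star}_\zeta C=v\zeta$, $D^{\star}\Gamma=0$) and satisfies, for all $\zeta,\eta$: $D^{\star}_{J\eta}g=0$, $T^{\star}(J\zeta,J\eta)=0$, $v\,T^{\star}(h\zeta,J\eta)=0$, where $T^{\star}(\zeta,\eta)=D^{\star}_\zeta\eta-D^{\star}_\eta\zeta-[\zeta,\eta]$. *)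

theory Defs
  imports "HOL-Analysis.Analysis" "HOL-Library.Function_Algebras"
begin

section \<open>Smooth maps between Euclidean spaces\<close>

text \<open>To be used on open sets only.\<close>

primrec Ck_on :: "nat \<Rightarrow> ('a::euclidean_space) set \<Rightarrow> ('a \<Rightarrow> 'b::real_normed_vector) \<Rightarrow> bool" where
  "Ck_on 0 S f \<longleftrightarrow> continuous_on S f"
| "Ck_on (Suc k) S f \<longleftrightarrow>
     (\<forall>x\<in>S. f differentiable (at x)) \<and>
     (\<forall>v. Ck_on k S (\<lambda>x. frechet_derivative f (at x) v))"

definition smooth_on :: "('a::euclidean_space) set \<Rightarrow> ('a \<Rightarrow> 'b::real_normed_vector) \<Rightarrow> bool" where
  "smooth_on S f \<longleftrightarrow> (\<forall>k. Ck_on k S f)"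


section \<open>Atlases, tangent vectors, vector fields\<close>

text \<open>A chart is a pair of its domain and its coordinate map (which is irrelevant outside the
  domain).\<close>

type_synonym ('a, 'e) chart = "'a set \<times> ('a \<Rightarrow> 'e)"

definition points :: "('a, 'e) chart set \<Rightarrow> 'a set" where
  "points A = (\<Union>c\<in>A. fst c)"

definition chart_image :: "('a, 'e) chart \<Rightarrow> 'e set" where
  "chart_image c = snd c ` fst c"

definition chart_inv :: "('a, 'e) chart \<Rightarrow> 'e \<Rightarrow> 'a" where
  "chart_inv c = inv_into (fst c) (snd c)"

definition transition :: "('a, 'e) chart \<Rightarrow> ('a, 'e) chart \<Rightarrow> 'e \<Rightarrow> 'e" where
  "transition c c' = snd c' \<circ> chart_inv c"

definition smooth_manifold :: "'a topology \<Rightarrow> ('a, 'e::euclidean_space) chart set \<Rightarrow> bool" where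
  "smooth_manifold M A \<longleftrightarrow>
     Hausdorff_space M \<and> second_countable M \<and> points A = topspace M \<and>
     (\<forall>c\<in>A. openin M (fst c) \<and> open (chart_image c) \<and>
        homeomorphic_map (subtopology M (fst c)) (top_of_set (chart_image c)) (snd c)) \<and>
     (\<forall>c\<in>A. \<forall>c'\<in>A. smooth_on (snd c ` (fst c \<inter> fst c')) (transition c c'))"

text \<open>A tangent vector at \<open>p\<close> is given by its components in all charts around \<open>p\<close>; the components
  in two charts are related by the Jacobian of the transition map. Components in charts
  not containing \<open>p\<close> are set to 0, so that equality of tangent vectors is equality of functions.\<close>

type_synonym ('a, 'e) tvector = "('a, 'e) chart \<Rightarrow> 'e"

definition tangent_space :: "('a, 'e::euclidean_space) chart set \<Rightarrow> 'a \<Rightarrow> ('a, 'e) tvector set" where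
  "tangent_space A p =
     {v. (\<forall>c. c \<notin> A \<or> p \<notin> fst c \<longrightarrow> v c = 0) \<and>
         (\<forall>c\<in>A. \<forall>c'\<in>A. p \<in> fst c \<and> p \<in> fst c' \<longrightarrow>
            v c' = frechet_derivative (transition c c') (at (snd c p)) (v c))}"

definition Ck_function ::
  "nat \<Rightarrow> ('a, 'e::euclidean_space) chart set \<Rightarrow> ('a \<Rightarrow> real) \<Rightarrow> bool" where
  "Ck_function k A f \<longleftrightarrow> (\<forall>c\<in>A. Ck_on k (chart_image c) (f \<circ> chart_inv c))"

definition smooth_function :: "('a, 'e::euclidean_space) chart set \<Rightarrow> ('a \<Rightarrow> real) \<Rightarrow> bool" where
  "smooth_function A f \<longleftrightarrow> (\<forall>k. Ck_function k A f)"

text \<open>Vector fields vanish outside \<open>points A\<close>, where the tangent space is \<open>{0}\<close>; hence equality of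
  vector fields is equality of functions. Addition and negation are pointwise.\<close>

type_synonym ('a, 'e) vfield = "'a \<Rightarrow> ('a, 'e) tvector"

definition vector_fields :: "('a, 'e::euclidean_space) chart set \<Rightarrow> ('a, 'e) vfield set" where
  "vector_fields A =
     {X. (\<forall>p. X p \<in> tangent_space A p) \<and>
         (\<forall>c\<in>A. smooth_on (chart_image c) (\<lambda>x. X (chart_inv c x) c))}"

definition fscale :: "('a \<Rightarrow> real) \<Rightarrow> ('a, 'e::euclidean_space) vfield \<Rightarrow> ('a, 'e) vfield" where
  "fscale f X = (\<lambda>p c. f p *\<^sub>R X p c)"

text \<open>The derivative \<open>X f\<close>, computed in an arbitrary chart around the point.\<close>

definition vderiv ::
  "('a, 'e::euclidean_space) chart set \<Rightarrow> ('a, 'e) vfield \<Rightarrow> ('a \<Rightarrow> real) \<Rightarrow> 'a \<Rightarrow> real" where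
  "vderiv A X f p =
     (let c = (SOME c. c \<in> A \<and> p \<in> fst c)
      in frechet_derivative (f \<circ> chart_inv c) (at (snd c p)) (X p c))"

definition lie_bracket ::
  "('a, 'e::euclidean_space) chart set \<Rightarrow> ('a, 'e) vfield \<Rightarrow> ('a, 'e) vfield \<Rightarrow> ('a, 'e) vfield" where
  "lie_bracket A X Y = (\<lambda>p c. if c \<in> A \<and> p \<in> fst c then
       frechet_derivative (\<lambda>x. Y (chart_inv c x) c) (at (snd c p)) (X p c)
     - frechet_derivative (\<lambda>x. X (chart_inv c x) c) (at (snd c p)) (Y p c)
     else 0)"

text \<open>Tensor fields are maps on vector fields that are linear over the smooth functions.\<close>

definition vector_1form ::
  "('a, 'e::euclidean_space) chart set \<Rightarrow> (('a, 'e) vfield \<Rightarrow> ('a, 'e) vfield) \<Rightarrow> bool" where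
  "vector_1form A K \<longleftrightarrow>
     (\<forall>X\<in>vector_fields A. K X \<in> vector_fields A) \<and>
     (\<forall>X\<in>vector_fields A. \<forall>Y\<in>vector_fields A. K (X + Y) = K X + K Y) \<and>
     (\<forall>f. \<forall>X\<in>vector_fields A. smooth_function A f \<longrightarrow> K (fscale f X) = fscale f (K X))"

definition linear_connection ::
  "('a, 'e::euclidean_space) chart set \<Rightarrow>
   (('a, 'e) vfield \<Rightarrow> ('a, 'e) vfield \<Rightarrow> ('a, 'e) vfield) \<Rightarrow> bool" where
  "linear_connection A D \<longleftrightarrow>
     (\<forall>Y\<in>vector_fields A. vector_1form A (\<lambda>X. D X Y)) \<and>
     (\<forall>X\<in>vector_fields A. \<forall>Y\<in>vector_fields A. \<forall>Z\<in>vector_fields A.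
        D X (Y + Z) = D X Y + D X Z) \<and>
     (\<forall>f. \<forall>X\<in>vector_fields A. \<forall>Y\<in>vector_fields A. smooth_function A f \<longrightarrow>
        D X (fscale f Y) = fscale (vderiv A X f) Y + fscale f (D X Y))"

definition torsion ::
  "('a, 'e::euclidean_space) chart set \<Rightarrow>
   (('a, 'e) vfield \<Rightarrow> ('a, 'e) vfield \<Rightarrow> ('a, 'e) vfield) \<Rightarrow>
   ('a, 'e) vfield \<Rightarrow> ('a, 'e) vfield \<Rightarrow> ('a, 'e) vfield" where
  "torsion A D X Y = D X Y - D Y X - lie_bracket A X Y"

text \<open>The Froelicher--Nijenhuis bracket of a vector 1-form with a vector field, resp. of two
  vector 1-forms.\<close>

definition FN_bracket10 ::
  "('a, 'e::euclidean_space) chart set \<Rightarrow> (('a, 'e) vfield \<Rightarrow> ('a, 'e) vfield) \<Rightarrow>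
   ('a, 'e) vfield \<Rightarrow> ('a, 'e) vfield \<Rightarrow> ('a, 'e) vfield" where
  "FN_bracket10 A K Y X = lie_bracket A (K X) Y - K (lie_bracket A X Y)"

definition FN_bracket11 ::
  "('a, 'e::euclidean_space) chart set \<Rightarrow> (('a, 'e) vfield \<Rightarrow> ('a, 'e) vfield) \<Rightarrow>
   (('a, 'e) vfield \<Rightarrow> ('a, 'e) vfield) \<Rightarrow>
   ('a, 'e) vfield \<Rightarrow> ('a, 'e) vfield \<Rightarrow> ('a, 'e) vfield" where
  "FN_bracket11 A K L X Y =
     lie_bracket A (K X) (L Y) + lie_bracket A (L X) (K Y)
     + K (L (lie_bracket A X Y)) + L (K (lie_bracket A X Y))
     - K (lie_bracket A (L X) Y) - L (lie_bracket A (K X) Y)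
     - K (lie_bracket A X (L Y)) - L (lie_bracket A X (K Y))"

text \<open>The exterior derivative of a 1-form and the Lie derivative of a covariant 2-tensor.\<close>

definition ext_deriv1 ::
  "('a, 'e::euclidean_space) chart set \<Rightarrow> (('a, 'e) vfield \<Rightarrow> 'a \<Rightarrow> real) \<Rightarrow>
   ('a, 'e) vfield \<Rightarrow> ('a, 'e) vfield \<Rightarrow> 'a \<Rightarrow> real" where
  "ext_deriv1 A \<omega> X Y p =
     vderiv A X (\<omega> Y) p - vderiv A Y (\<omega> X) p - \<omega> (lie_bracket A X Y) p"

definition lie_deriv2 ::
  "('a, 'e::euclidean_space) chart set \<Rightarrow> ('a, 'e) vfield \<Rightarrow>
   (('a, 'e) vfield \<Rightarrow> ('a, 'e) vfield \<Rightarrow> 'a \<Rightarrow> real) \<Rightarrow>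
   ('a, 'e) vfield \<Rightarrow> ('a, 'e) vfield \<Rightarrow> 'a \<Rightarrow> real" where
  "lie_deriv2 A X b Y Z p =
     vderiv A X (b Y Z) p - b (lie_bracket A X Y) Z p - b Y (lie_bracket A X Z) p"


section \<open>The tangent bundle\<close>

type_synonym ('m, 'n) tm = "'m \<times> ('m, real^'n) tvector"

definition tangent_bundle :: "('m, real^'n) chart set \<Rightarrow> ('m, 'n) tm set" where
  "tangent_bundle A = {(p, v). p \<in> points A \<and> v \<in> tangent_space A p}"

definition slit_bundle :: "('m, real^'n) chart set \<Rightarrow> ('m, 'n) tm set" where
  "slit_bundle A = {(p, v) \<in> tangent_bundle A. v \<noteq> 0}"

text \<open>The coordinates \<open>(x, y)\<close> induced by a chart, on the part of the bundle inside \<open>W\<close>.\<close>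

definition induced_chart ::
  "('m, 'n) tm set \<Rightarrow> ('m, real^'n) chart \<Rightarrow> (('m, 'n) tm, (real^'n) \<times> (real^'n)) chart" where
  "induced_chart W c = ({z \<in> W. fst z \<in> fst c}, \<lambda>z. (snd c (fst z), snd z c))"

definition tangent_atlas ::
  "('m, real^'n) chart set \<Rightarrow> (('m, 'n) tm, (real^'n) \<times> (real^'n)) chart set" where
  "tangent_atlas A = induced_chart (tangent_bundle A) ` A"

definition slit_atlas ::
  "('m, real^'n) chart set \<Rightarrow> (('m, 'n) tm, (real^'n) \<times> (real^'n)) chart set" where
  "slit_atlas A = induced_chart (slit_bundle A) ` A"

type_synonym ('m, 'n) tm_field = "(('m, 'n) tm, (real^'n) \<times> (real^'n)) vfield"

abbreviation VF :: "('m, real^'n) chart set \<Rightarrow> ('m, 'n) tm_field set" where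
  "VF A \<equiv> vector_fields (slit_atlas A)"

abbreviation br ::
  "('m, real^'n) chart set \<Rightarrow> ('m, 'n) tm_field \<Rightarrow> ('m, 'n) tm_field \<Rightarrow> ('m, 'n) tm_field" where
  "br A \<equiv> lie_bracket (slit_atlas A)"

abbreviation der ::
  "('m, real^'n) chart set \<Rightarrow> ('m, 'n) tm_field \<Rightarrow> (('m, 'n) tm \<Rightarrow> real) \<Rightarrow> ('m, 'n) tm \<Rightarrow> real" where
  "der A \<equiv> vderiv (slit_atlas A)"

text \<open>A tangent vector of the tangent bundle has induced components \<open>(a, b)\<close>, standing for
  \<open>a\<^sup>i \<partial>/\<partial>x\<^sup>i + b\<^sup>i \<partial>/\<partial>y\<^sup>i\<close>, and \<open>J = \<partial>/\<partial>y\<^sup>i \<otimes> dx\<^sup>i\<close> sends it to \<open>(0, a)\<close>.\<close>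

definition J :: "('m, 'n::finite) tm_field \<Rightarrow> ('m, 'n) tm_field" where
  "J X = (\<lambda>z c. (0, fst (X z c)))"

definition liouville :: "('m, real^'n) chart set \<Rightarrow> ('m, 'n) tm_field" where
  "liouville A = (\<lambda>z c. if c \<in> slit_atlas A \<and> z \<in> fst c then (0, snd (snd c z)) else 0)"


section \<open>Finsler manifolds\<close>

definition dJ ::
  "('m, real^'n) chart set \<Rightarrow> (('m, 'n) tm \<Rightarrow> real) \<Rightarrow> ('m, 'n) tm_field \<Rightarrow> ('m, 'n) tm \<Rightarrow> real" where
  "dJ A E X = der A (J X) E"

definition Omega ::
  "('m, real^'n) chart set \<Rightarrow> (('m, 'n) tm \<Rightarrow> real) \<Rightarrow>
   ('m, 'n) tm_field \<Rightarrow> ('m, 'n) tm_field \<Rightarrow> ('m, 'n) tm \<Rightarrow> real" where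
  "Omega A E = ext_deriv1 (slit_atlas A) (dJ A E)"

text \<open>In the last clause, the value of \<open>Omega A E X Y\<close> at \<open>z\<close> depends only on \<open>X z\<close> and \<open>Y z\<close>, and
  every tangent vector at \<open>z\<close> is the value of some vector field; so the clause says that the
  bilinear form at each \<open>z\<close> has trivial kernel, i.e. rank \<open>2n\<close>.\<close>

definition finsler_manifold ::
  "'m topology \<Rightarrow> ('m, real^'n) chart set \<Rightarrow> (('m, 'n) tm \<Rightarrow> real) \<Rightarrow> bool" where
  "finsler_manifold M A E \<longleftrightarrow>
     smooth_manifold M A \<and>
     (\<forall>z\<in>slit_bundle A. E z > 0) \<and>
     (\<forall>p\<in>topspace M. E (p, 0) = 0) \<and>
     smooth_function (slit_atlas A) E \<and>
     Ck_function 1 (tangent_atlas A) E \<and>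
     (\<forall>z\<in>slit_bundle A. der A (liouville A) E z = 2 * E z) \<and>
     (\<forall>z\<in>slit_bundle A. \<forall>X\<in>VF A. X z \<noteq> 0 \<longrightarrow> (\<exists>Y\<in>VF A. Omega A E X Y z \<noteq> 0))"

definition canonical_spray ::
  "('m, real^'n) chart set \<Rightarrow> (('m, 'n) tm \<Rightarrow> real) \<Rightarrow> ('m, 'n) tm_field \<Rightarrow> bool" where
  "canonical_spray A E S \<longleftrightarrow>
     S \<in> VF A \<and> (\<forall>X\<in>VF A. \<forall>z\<in>slit_bundle A. Omega A E S X z = - der A X E z)"

text \<open>From here on \<open>S\<close> is the canonical spray.\<close>

definition barthel ::
  "('m, real^'n) chart set \<Rightarrow> ('m, 'n) tm_field \<Rightarrow> ('m, 'n) tm_field \<Rightarrow> ('m, 'n) tm_field" where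
  "barthel A S = FN_bracket10 (slit_atlas A) J S"

definition hproj ::
  "('m, real^'n) chart set \<Rightarrow> ('m, 'n) tm_field \<Rightarrow> ('m, 'n) tm_field \<Rightarrow> ('m, 'n) tm_field" where
  "hproj A S X = fscale (\<lambda>_. 1/2) (X + barthel A S X)"

definition vproj ::
  "('m, real^'n) chart set \<Rightarrow> ('m, 'n) tm_field \<Rightarrow> ('m, 'n) tm_field \<Rightarrow> ('m, 'n) tm_field" where
  "vproj A S X = fscale (\<lambda>_. 1/2) (X - barthel A S X)"

definition almost_complex_structure ::
  "('m, real^'n) chart set \<Rightarrow> ('m, 'n) tm_field \<Rightarrow> (('m, 'n) tm_field \<Rightarrow> ('m, 'n) tm_field) \<Rightarrow> bool" where
  "almost_complex_structure A S F \<longleftrightarrow>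
     vector_1form (slit_atlas A) F \<and>
     (\<forall>X\<in>VF A. F (J X) = hproj A S X \<and> F (hproj A S X) = - J X)"

definition curvature ::
  "('m, real^'n) chart set \<Rightarrow> ('m, 'n) tm_field \<Rightarrow>
   ('m, 'n) tm_field \<Rightarrow> ('m, 'n) tm_field \<Rightarrow> ('m, 'n) tm_field" where
  "curvature A S X Y =
     fscale (\<lambda>_. - 1/2) (FN_bracket11 (slit_atlas A) (hproj A S) (hproj A S) X Y)"

text \<open>The vertical metric, given by \<open>vmetric A E (J X) (J Y) = Omega A E (J X) Y\<close>. This does not
  depend on the choice of \<open>Y\<close>, since \<open>Omega A E\<close> vanishes on pairs of vertical fields, and every
  vertical field is of the form \<open>J Y\<close>.\<close>

definition vmetric ::
  "('m, real^'n) chart set \<Rightarrow> (('m, 'n) tm \<Rightarrow> real) \<Rightarrow>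
   ('m, 'n) tm_field \<Rightarrow> ('m, 'n) tm_field \<Rightarrow> ('m, 'n) tm \<Rightarrow> real" where
  "vmetric A E V W = Omega A E V (SOME Y. Y \<in> VF A \<and> J Y = W)"

definition metric ::
  "('m, real^'n) chart set \<Rightarrow> (('m, 'n) tm \<Rightarrow> real) \<Rightarrow> ('m, 'n) tm_field \<Rightarrow>
   ('m, 'n) tm_field \<Rightarrow> ('m, 'n) tm_field \<Rightarrow> ('m, 'n) tm \<Rightarrow> real" where
  "metric A E S X Y z =
     vmetric A E (J X) (J Y) z + vmetric A E (vproj A S X) (vproj A S Y) z"

text \<open>Symmetry, semi-basicity and \<open>\<C> X S = 0\<close> are consequences of this definition.\<close>

definition first_cartan_tensor ::
  "('m, real^'n) chart set \<Rightarrow> (('m, 'n) tm \<Rightarrow> real) \<Rightarrow> ('m, 'n) tm_field \<Rightarrow>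
   (('m, 'n) tm_field \<Rightarrow> ('m, 'n) tm_field \<Rightarrow> ('m, 'n) tm_field) \<Rightarrow> bool" where
  "first_cartan_tensor A E S \<C> \<longleftrightarrow>
     (\<forall>X\<in>VF A. vector_1form (slit_atlas A) (\<C> X)) \<and>
     (\<forall>Y\<in>VF A. vector_1form (slit_atlas A) (\<lambda>X. \<C> X Y)) \<and>
     (\<forall>X\<in>VF A. \<forall>Y\<in>VF A. J (\<C> X Y) = 0) \<and>
     (\<forall>X\<in>VF A. \<forall>Y\<in>VF A. \<forall>Z\<in>VF A. \<forall>z\<in>slit_bundle A.
        Omega A E (\<C> X Y) Z z =
          1/2 * lie_deriv2 (slit_atlas A) (J X) (\<lambda>Y Z. metric A E S (J Y) (J Z)) Y Z z)"

definition lift_of_barthel ::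
  "('m, real^'n) chart set \<Rightarrow> ('m, 'n) tm_field \<Rightarrow>
   (('m, 'n) tm_field \<Rightarrow> ('m, 'n) tm_field \<Rightarrow> ('m, 'n) tm_field) \<Rightarrow> bool" where
  "lift_of_barthel A S D \<longleftrightarrow>
     (\<forall>X\<in>VF A. \<forall>Y\<in>VF A. D X (J Y) = J (D X Y)) \<and>
     (\<forall>X\<in>VF A. D X (liouville A) = vproj A S X) \<and>
     (\<forall>X\<in>VF A. \<forall>Y\<in>VF A. D X (barthel A S Y) = barthel A S (D X Y))"

definition hashiguchi_connection ::
  "('m, real^'n) chart set \<Rightarrow> (('m, 'n) tm \<Rightarrow> real) \<Rightarrow> ('m, 'n) tm_field \<Rightarrow>
   (('m, 'n) tm_field \<Rightarrow> ('m, 'n) tm_field \<Rightarrow> ('m, 'n) tm_field) \<Rightarrow> bool" where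
  "hashiguchi_connection A E S D \<longleftrightarrow>
     linear_connection (slit_atlas A) D \<and>
     lift_of_barthel A S D \<and>
     (\<forall>X\<in>VF A. \<forall>Y\<in>VF A. \<forall>Z\<in>VF A. \<forall>z\<in>slit_bundle A.
        der A (J X) (metric A E S Y Z) z =
          metric A E S (D (J X) Y) Z z + metric A E S Y (D (J X) Z) z) \<and>
     (\<forall>X\<in>VF A. \<forall>Y\<in>VF A. torsion (slit_atlas A) D (J X) (J Y) = 0) \<and>
     (\<forall>X\<in>VF A. \<forall>Y\<in>VF A. vproj A S (torsion (slit_atlas A) D (hproj A S X) (J Y)) = 0)"

end

theory Submission
  imports Defs
begin

text \<open>The spray satisfies \<open>J S = C\<close>, so that \<open>J [V, S] = V\<close> for every vertical \<open>V\<close>; hence \<open>J\<close> maps onto the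
  vertical fields and every claim about horizontal fields may be tested after applying \<open>J\<close>.
  For (a), \<open>v T(h\<zeta>, J\<xi>) = 0\<close> gives \<open>J (D (h\<zeta>) \<xi>) = v [h\<zeta>, J\<xi>]\<close>, and \<open>J T(h\<zeta>, h\<xi>) = 0\<close> becomes
  \<open>[J, \<Gamma>] = 0\<close>, which is the derivative along \<open>S\<close> of the vanishing Nijenhuis torsion of \<open>J\<close>. So the
  torsion equals its vertical part \<open>- v [h\<zeta>, h\<xi>]\<close>, which is the curvature.
  For (b), applying \<open>J\<close> turns the claim into \<open>\<C>(\<zeta>, \<xi>) = D (J\<zeta>) (J\<xi>) - J [J\<zeta>, \<xi>]\<close>. The right-hand side is
  symmetric since \<open>T(J\<zeta>, J\<xi>) = 0\<close>, and metricity together with \<open>d\<Omega> = 0\<close> identifies it with \<open>\<C>\<close>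
  as in the uniqueness proof for the Levi-Civita connection.\<close>

section \<open>Smooth maps and their second derivatives\<close>

text \<open>\<open>J S = C\<close> is not part of the definition of the spray. Since
  \<open>i_J \<Omega> = 0\<close>, the equation \<open>i_S \<Omega> = - dE\<close> becomes
  \<open>\<Omega>(J S, X) = (J X) E\<close>; homogeneity of degree 2 gives
  \<open>\<Omega>(C, X) = (J X) E\<close> as well, and nondegeneracy identifies the two fields.
  Testing horizontal fields with \<open>J\<close> is legitimate because \<open>J h = J\<close> and
  \<open>h\<close> kills \<open>ker J\<close>, so \<open>h Y = 0\<close> as soon as
  \<open>J Y = 0\<close>. The bulk of the work is to establish that the fields over the slit bundle
  form a Lie algebra acting on smooth functions. All of it rests on the symmetry of second
  derivatives. Coordinates then enter the geometry through three identities,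
  \<open>[J X, J Y] = J [J X, Y] + J [X, J Y]\<close>, \<open>[C, J X] = J [C, X] - J X\<close> and
  \<open>J [V, S] = V\<close> for vertical \<open>V\<close>; the rest is algebra with global fields.
  Fields are compared by pairing their difference with every global field through \<Omega>, so no
  tensor has to be localised and no bump functions occur.\<close>

lemma Ck_on_cong:
  assumes "open S" "\<And>x. x \<in> S \<Longrightarrow> f x = g x" "Ck_on k S f"
  shows "Ck_on k S g"
  using assms(2,3)
proof (induction k arbitrary: f g)
  case 0
  then show ?case by (simp cong: continuous_on_cong)
next
  case (Suc k)
  have eq: "frechet_derivative f (at x) = frechet_derivative g (at x)" if "x \<in> S" for x
    using Suc.prems that assms(1) by (auto intro!: frechet_derivative_transform_within_open)
  have "g differentiable at x" if "x \<in> S" for x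
    using Suc.prems that assms(1)
    by (metis Ck_on.simps(2) differentiable_def has_derivative_transform_within_open)
  moreover have "Ck_on k S (\<lambda>x. frechet_derivative g (at x) v)" for v
    by (rule Suc.IH[of "\<lambda>x. frechet_derivative f (at x) v"]) (use eq Suc.prems in auto)
  ultimately show ?case by simp
qed

lemma Ck_on_SucD: "Ck_on (Suc k) S f \<Longrightarrow> Ck_on k S f"
proof (induction k arbitrary: f)
  case 0
  then show ?case
    by (auto intro!: continuous_at_imp_continuous_on differentiable_imp_continuous_within)
next
  case (Suc k)
  then show ?case by (metis Ck_on.simps(2))
qed

lemma Ck_on_subset: "Ck_on k S f \<Longrightarrow> T \<subseteq> S \<Longrightarrow> Ck_on k T f"
  by (induction k arbitrary: f) (auto intro: continuous_on_subset)

text \<open>Lets the closure proofs below exhibit a derivative by \<open>has_derivative\<close>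
  rules; the passage to \<open>frechet_derivative\<close>, which agrees with it only on the open
  set, is made once here.\<close>

lemma Ck_on_SucI:
  assumes "open S" "\<And>x. x \<in> S \<Longrightarrow> (f has_derivative f' x) (at x)"
    and "\<And>v. Ck_on k S (\<lambda>x. f' x v)"
  shows "Ck_on (Suc k) S f"
proof -
  have "frechet_derivative f (at x) = f' x" if "x \<in> S" for x
    using frechet_derivative_at[OF assms(2)[OF that]] by simp
  then have "Ck_on k S (\<lambda>x. frechet_derivative f (at x) v)" for v
    using assms by (auto intro!: Ck_on_cong[OF assms(1) _ assms(3)[of v]])
  then show ?thesis using assms(2) by (auto simp: differentiable_def)
qed

lemma Ck_on_const: "Ck_on k S (\<lambda>x. c)"
  by (induction k arbitrary: c) auto

lemma Ck_on_SucE: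
  assumes "Ck_on (Suc k) S f" "x \<in> S"
  shows "(f has_derivative frechet_derivative f (at x)) (at x)"
  using assms by (simp add: frechet_derivative_works)

lemma Ck_on_bounded_linear_compose:
  assumes "open S" "bounded_linear h" "Ck_on k S f"
  shows "Ck_on k S (\<lambda>x. h (f x))"
  using assms(3)
proof (induction k arbitrary: f)
  case 0
  then show ?case by (auto intro: bounded_linear.continuous_on[OF assms(2)])
next
  case (Suc k)
  show ?case
  proof (rule Ck_on_SucI[OF assms(1)])
    show "((\<lambda>x. h (f x)) has_derivative (\<lambda>v. h (frechet_derivative f (at x) v))) (at x)" if "x \<in> S" for x
      using Ck_on_SucE[OF Suc.prems that] by (rule bounded_linear.has_derivative[OF assms(2)])
    show "Ck_on k S (\<lambda>x. h (frechet_derivative f (at x) v))" for v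
      using Suc by simp
  qed
qed

lemma Ck_on_add:
  assumes "open S" "Ck_on k S f" "Ck_on k S g"
  shows "Ck_on k S (\<lambda>x. f x + g x)"
  using assms(2,3)
proof (induction k arbitrary: f g)
  case 0
  then show ?case by (auto intro: continuous_intros)
next
  case (Suc k)
  show ?case
  proof (rule Ck_on_SucI[OF assms(1)])
    show "((\<lambda>x. f x + g x) has_derivative
        (\<lambda>v. frechet_derivative f (at x) v + frechet_derivative g (at x) v)) (at x)" if "x \<in> S" for x
      using Ck_on_SucE[OF Suc.prems(1) that] Ck_on_SucE[OF Suc.prems(2) that] by (rule has_derivative_add)
    show "Ck_on k S (\<lambda>x. frechet_derivative f (at x) v + frechet_derivative g (at x) v)" for v
      using Suc by simp
  qed
qed

lemma Ck_on_scaleR: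
  assumes "open S" "Ck_on k S f" "Ck_on k S g"
  shows "Ck_on k S (\<lambda>x. f x *\<^sub>R g x)"
  using assms(2,3)
proof (induction k arbitrary: f g)
  case 0
  then show ?case by (auto intro: continuous_intros)
next
  case (Suc k)
  show ?case
  proof (rule Ck_on_SucI[OF assms(1)])
    show "((\<lambda>x. f x *\<^sub>R g x) has_derivative
        (\<lambda>v. f x *\<^sub>R frechet_derivative g (at x) v + frechet_derivative f (at x) v *\<^sub>R g x)) (at x)"
      if "x \<in> S" for x
      using Ck_on_SucE[OF Suc.prems(1) that] Ck_on_SucE[OF Suc.prems(2) that] by (rule has_derivative_scaleR)
    show "Ck_on k S (\<lambda>x. f x *\<^sub>R frechet_derivative g (at x) v + frechet_derivative f (at x) v *\<^sub>R g x)" for v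
      using Suc Ck_on_SucD[OF Suc.prems(1)] Ck_on_SucD[OF Suc.prems(2)]
      by (intro Ck_on_add[OF assms(1)]) auto
  qed
qed

lemma Ck_on_sum:
  assumes "open S" "finite I" "\<And>i. i \<in> I \<Longrightarrow> Ck_on k S (f i)"
  shows "Ck_on k S (\<lambda>x. \<Sum>i\<in>I. f i x)"
  using assms(2,3) by (induction I rule: finite_induct) (auto intro: Ck_on_const Ck_on_add[OF assms(1)])

lemma linear_Basis_expansion:
  fixes L :: "'a::euclidean_space \<Rightarrow> 'b::real_vector"
  assumes "linear L"
  shows "L v = (\<Sum>b\<in>Basis. (v \<bullet> b) *\<^sub>R L b)"
proof -
  have "L v = L (\<Sum>b\<in>Basis. (v \<bullet> b) *\<^sub>R b)"
    by (simp add: euclidean_representation)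
  then show ?thesis
    using assms by (simp add: linear_sum linear_scale)
qed

text \<open>\<open>Ck_on\<close> controls derivatives in constant directions only. A varying
  direction \<open>Y x\<close> is reduced to these by expanding it in the basis.\<close>

lemma Ck_on_frechet_apply:
  fixes f :: "'a::euclidean_space \<Rightarrow> 'b::real_normed_vector" and T :: "'c::euclidean_space set"
  assumes "open T" "g ` T \<subseteq> S" "\<And>x. x \<in> S \<Longrightarrow> f differentiable (at x)"
    and "\<And>b. b \<in> Basis \<Longrightarrow> Ck_on k T (\<lambda>x. frechet_derivative f (at (g x)) b)" "Ck_on k T Y"
  shows "Ck_on k T (\<lambda>x. frechet_derivative f (at (g x)) (Y x))"
proof (rule Ck_on_cong[OF assms(1)])
  show "(\<Sum>b\<in>Basis. (Y x \<bullet> b) *\<^sub>R frechet_derivative f (at (g x)) b) = frechet_derivative f (at (g x)) (Y x)"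
    if "x \<in> T" for x
    using that assms(2,3) by (intro linear_Basis_expansion[symmetric] linear_frechet_derivative) auto
  show "Ck_on k T (\<lambda>x. \<Sum>b\<in>Basis. (Y x \<bullet> b) *\<^sub>R frechet_derivative f (at (g x)) b)"
    using assms
    by (intro Ck_on_sum Ck_on_scaleR Ck_on_bounded_linear_compose[OF _ bounded_linear_inner_left]) auto
qed

lemma Ck_on_compose:
  fixes f :: "'a::euclidean_space \<Rightarrow> 'b::real_normed_vector" and T :: "'c::euclidean_space set"
  assumes "open T" "g ` T \<subseteq> S" "Ck_on k S f" "Ck_on k T g"
  shows "Ck_on k T (\<lambda>x. f (g x))"
  using assms(3,4)
proof (induction k arbitrary: f)
  case 0
  then show ?case using assms(2) by (auto intro: continuous_on_compose2)
next
  case (Suc k)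
  show ?case
  proof (rule Ck_on_SucI[OF assms(1)])
    show "((\<lambda>x. f (g x)) has_derivative
        (\<lambda>v. frechet_derivative f (at (g x)) (frechet_derivative g (at x) v))) (at x)" if "x \<in> T" for x
      using Ck_on_SucE[OF Suc.prems(2) that] Ck_on_SucE[OF Suc.prems(1)] that assms(2)
      by (blast intro: has_derivative_compose)
    show "Ck_on k T (\<lambda>x. frechet_derivative f (at (g x)) (frechet_derivative g (at x) v))" for v
    proof (rule Ck_on_frechet_apply[OF assms(1,2)])
      show "f differentiable at x" if "x \<in> S" for x
        using Suc.prems(1) that by simp
      show "Ck_on k T (\<lambda>x. frechet_derivative f (at (g x)) b)" for b
        using Suc.IH[of "\<lambda>y. frechet_derivative f (at y) b"] Suc.prems(1) Ck_on_SucD[OF Suc.prems(2)]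
        by simp
      show "Ck_on k T (\<lambda>x. frechet_derivative g (at x) v)"
        using Suc.prems(2) by simp
    qed
  qed
qed

lemma smooth_onD:
  assumes "smooth_on S f" "x \<in> S"
  shows "(f has_derivative frechet_derivative f (at x)) (at x)"
  using assms unfolding smooth_on_def by (blast intro: Ck_on_SucE)

lemma smooth_on_differentiable: "smooth_on S f \<Longrightarrow> x \<in> S \<Longrightarrow> f differentiable (at x)"
  using smooth_onD differentiable_def by blast

lemma smooth_on_frechet_linear: "smooth_on S f \<Longrightarrow> x \<in> S \<Longrightarrow> linear (frechet_derivative f (at x))"
  by (simp add: smooth_on_differentiable linear_frechet_derivative)

lemma smooth_on_frechet: "smooth_on S f \<Longrightarrow> smooth_on S (\<lambda>x. frechet_derivative f (at x) v)"
  unfolding smooth_on_def by (metis Ck_on.simps(2))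

lemma smooth_on_cong: "open S \<Longrightarrow> (\<And>x. x \<in> S \<Longrightarrow> f x = g x) \<Longrightarrow> smooth_on S f \<Longrightarrow> smooth_on S g"
  unfolding smooth_on_def using Ck_on_cong by metis

lemma smooth_on_subset: "smooth_on S f \<Longrightarrow> T \<subseteq> S \<Longrightarrow> smooth_on T f"
  unfolding smooth_on_def using Ck_on_subset by blast

lemma smooth_on_const: "smooth_on S (\<lambda>x. c)"
  unfolding smooth_on_def by (simp add: Ck_on_const)

lemma smooth_on_bounded_linear_compose:
  "open S \<Longrightarrow> bounded_linear h \<Longrightarrow> smooth_on S f \<Longrightarrow> smooth_on S (\<lambda>x. h (f x))"
  unfolding smooth_on_def by (simp add: Ck_on_bounded_linear_compose)

lemma smooth_on_add:
  "open S \<Longrightarrow> smooth_on S f \<Longrightarrow> smooth_on S g \<Longrightarrow> smooth_on S (\<lambda>x. f x + g x)"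
  unfolding smooth_on_def by (simp add: Ck_on_add)

lemma smooth_on_minus: "open S \<Longrightarrow> smooth_on S f \<Longrightarrow> smooth_on S (\<lambda>x. - f x)"
  by (rule smooth_on_bounded_linear_compose[OF _ bounded_linear_minus[OF bounded_linear_ident]])

lemma smooth_on_diff:
  "open S \<Longrightarrow> smooth_on S f \<Longrightarrow> smooth_on S g \<Longrightarrow> smooth_on S (\<lambda>x. f x - g x)"
  using smooth_on_add[of S f "\<lambda>x. - g x"] smooth_on_minus[of S g] by simp

lemma smooth_on_scaleR:
  "open S \<Longrightarrow> smooth_on S f \<Longrightarrow> smooth_on S g \<Longrightarrow> smooth_on S (\<lambda>x. f x *\<^sub>R g x)"
  unfolding smooth_on_def by (simp add: Ck_on_scaleR)

lemma smooth_on_ident: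
  assumes "open S"
  shows "smooth_on S (\<lambda>x. x)"
proof -
  have "Ck_on k S (\<lambda>x. x)" for k
    by (cases k) (simp_all add: Ck_on_const)
  then show ?thesis by (simp add: smooth_on_def)
qed

lemma smooth_on_bounded_linear: "open S \<Longrightarrow> bounded_linear h \<Longrightarrow> smooth_on S h"
  using smooth_on_bounded_linear_compose[of S h "\<lambda>x. x"] smooth_on_ident by blast

lemma smooth_on_Pair:
  assumes "open S" "smooth_on S f" "smooth_on S g"
  shows "smooth_on S (\<lambda>x. (f x, g x))"
proof -
  have "smooth_on S (\<lambda>x. (f x, 0) + (0, g x))"
    using assms
    by (intro smooth_on_add smooth_on_bounded_linear_compose[of S "\<lambda>a. (a, 0)"]
        smooth_on_bounded_linear_compose[of S "\<lambda>a. (0, a)"])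
      (auto intro: bounded_linear_Pair bounded_linear_ident bounded_linear_zero)
  then show ?thesis by simp
qed

lemma smooth_on_compose:
  fixes f :: "'a::euclidean_space \<Rightarrow> 'b::real_normed_vector" and T :: "'c::euclidean_space set"
  shows "open T \<Longrightarrow> g ` T \<subseteq> S \<Longrightarrow> smooth_on S f \<Longrightarrow> smooth_on T g \<Longrightarrow> smooth_on T (\<lambda>x. f (g x))"
  unfolding smooth_on_def using Ck_on_compose by blast

lemma smooth_on_frechet_apply:
  fixes f :: "'a::euclidean_space \<Rightarrow> 'b::real_normed_vector" and T :: "'c::euclidean_space set"
  assumes "open T" "g ` T \<subseteq> S" "smooth_on S f" "smooth_on T g" "smooth_on T Y"
  shows "smooth_on T (\<lambda>x. frechet_derivative f (at (g x)) (Y x))"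
  using smooth_on_compose[OF assms(1,2) smooth_on_frechet[OF assms(3)] assms(4)]
    Ck_on_frechet_apply[OF assms(1,2) smooth_on_differentiable[OF assms(3)]] assms(5)
  unfolding smooth_on_def by blast

text \<open>The classical second-difference proof: two applications of the mean value theorem turn
  one symmetric expression into either mixed derivative at a nearby point, and continuity lets the
  point tend to \<open>x\<close>.\<close>

lemma second_derivative_symmetric_real:
  fixes f :: "'a::euclidean_space \<Rightarrow> real"
  assumes "open U" "x \<in> U" "Ck_on (Suc (Suc 0)) U f"
  shows "frechet_derivative (\<lambda>y. frechet_derivative f (at y) v) (at x) u =
         frechet_derivative (\<lambda>y. frechet_derivative f (at y) u) (at x) v"
proof -
  define d where "d w y = frechet_derivative f (at y) w" for w y
  define dd where "dd w w' y = frechet_derivative (d w) (at y) w'" for w w' y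
  have f: "(f has_derivative (\<lambda>w. d w y)) (at y)" if "y \<in> U" for y
    using Ck_on_SucE[OF assms(3) that] by (simp add: d_def)
  have d: "(d w has_derivative (\<lambda>w'. dd w w' y)) (at y)" if "y \<in> U" for w y
  proof -
    have "Ck_on (Suc 0) U (d w)"
      using assms(3) unfolding d_def Ck_on.simps(2) by blast
    from Ck_on_SucE[OF this that] show ?thesis by (simp add: dd_def)
  qed
  have cont: "continuous_on U (dd w w')" for w w'
    using assms(3) unfolding dd_def d_def by simp
  have line: "((\<lambda>s. g (p + s *\<^sub>R w)) has_real_derivative G w) (at s)"
    if G: "(g has_derivative G) (at (p + s *\<^sub>R w))" for g :: "'a \<Rightarrow> real" and G p s w
  proof -
    have "((\<lambda>s. p + s *\<^sub>R w) has_derivative (\<lambda>r. r *\<^sub>R w)) (at s)"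
      by (auto intro!: derivative_eq_intros)
    then have "((\<lambda>s. g (p + s *\<^sub>R w)) has_derivative (\<lambda>r. G (r *\<^sub>R w))) (at s)"
      using G by (rule has_derivative_compose)
    then show ?thesis
      by (simp add: has_field_derivative_def linear_scale[OF has_derivative_linear[OF G]] mult_commute_abs)
  qed
  obtain e where e: "e > 0" "ball x e \<subseteq> U"
    using assms(1,2) openE by blast
  \<comment> \<open>The second difference over the parallelogram with sides \<open>h a\<close> and
    \<open>h b\<close>; its symmetry in \<open>a\<close> and \<open>b\<close> is what yields the
    result.\<close>
  define Q where "Q h a b = f (x + h *\<^sub>R a + h *\<^sub>R b) - f (x + h *\<^sub>R a) - f (x + h *\<^sub>R b) + f x"
    for h :: real and a b
  have key: "\<exists>s t. 0 < s \<and> s < h \<and> 0 < t \<and> t < h \<and> Q h a b = h * h * dd a b (x + s *\<^sub>R a + t *\<^sub>R b)"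
    if h: "h > 0" "h * (norm a + norm b) < e" for a b h
  proof -
    have inU: "x + s *\<^sub>R a + t *\<^sub>R b \<in> U" if "0 \<le> s" "s \<le> h" "0 \<le> t" "t \<le> h" for s t
    proof -
      have "norm (s *\<^sub>R a + t *\<^sub>R b) \<le> s * norm a + t * norm b"
        using norm_triangle_ineq[of "s *\<^sub>R a" "t *\<^sub>R b"] that by simp
      also have "\<dots> \<le> h * norm a + h * norm b"
        using that by (intro add_mono mult_right_mono) auto
      finally have "norm (s *\<^sub>R a + t *\<^sub>R b) < e"
        using h(2) by (simp add: algebra_simps)
      then have "x + (s *\<^sub>R a + t *\<^sub>R b) \<in> ball x e"
        by (simp add: dist_norm norm_minus_commute add.commute)
      then show ?thesis using e(2) by (auto simp: add.assoc)
    qed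
    define g where "g s = f (x + h *\<^sub>R b + s *\<^sub>R a) - f (x + s *\<^sub>R a)" for s
    have g: "(g has_real_derivative d a (x + h *\<^sub>R b + s *\<^sub>R a) - d a (x + s *\<^sub>R a)) (at s)"
      if "0 \<le> s" "s \<le> h" for s
    proof -
      have "x + h *\<^sub>R b + s *\<^sub>R a \<in> U" "x + s *\<^sub>R a \<in> U"
        using inU[of s h] inU[of s 0] that h by (auto simp: algebra_simps)
      then show ?thesis
        unfolding g_def using DERIV_diff[OF line[OF f] line[OF f]] by blast
    qed
    \<comment> \<open>Mean value theorem along \<open>a\<close> for the difference of
      \<open>f\<close> on two parallel sides; \<open>k\<close> below then handles the direction
      \<open>b\<close>.\<close>
    obtain s where s: "0 < s" "s < h" "g h - g 0 = h * (d a (x + h *\<^sub>R b + s *\<^sub>R a) - d a (x + s *\<^sub>R a))"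
      using MVT2[OF h(1) g] by auto
    define k where "k t = d a (x + s *\<^sub>R a + t *\<^sub>R b)" for t
    have k: "(k has_real_derivative dd a b (x + s *\<^sub>R a + t *\<^sub>R b)) (at t)"
      if "0 \<le> t" "t \<le> h" for t
      unfolding k_def using line[OF d, of "x + s *\<^sub>R a" t b a] inU[of s t] that s by simp
    obtain t where t: "0 < t" "t < h" "k h - k 0 = h * dd a b (x + s *\<^sub>R a + t *\<^sub>R b)"
      using MVT2[OF h(1) k] by auto
    have "Q h a b = g h - g 0" by (simp add: Q_def g_def algebra_simps)
    also have "\<dots> = h * (k h - k 0)" using s(3) by (simp add: k_def algebra_simps)
    finally show ?thesis using s t by auto
  qed
  have lim: "\<exists>\<delta>>0. \<forall>y. dist y x < \<delta> \<longrightarrow> \<bar>dd a b y - dd a b x\<bar> < \<epsilon>" if "\<epsilon> > 0" for \<epsilon> a b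
  proof -
    have "isCont (dd a b) x"
      using cont[of a b] assms(1,2) by (simp add: continuous_on_eq_continuous_at)
    then show ?thesis
      using that unfolding continuous_at_eps_delta dist_real_def by blast
  qed
  have "\<bar>dd v u x - dd u v x\<bar> \<le> \<epsilon>" if eps: "\<epsilon> > 0" for \<epsilon>
  proof -
    obtain \<delta>1 where \<delta>1: "\<delta>1 > 0" "\<And>y. dist y x < \<delta>1 \<Longrightarrow> \<bar>dd v u y - dd v u x\<bar> < \<epsilon>/2"
      using lim[of "\<epsilon>/2" v u] eps by auto
    obtain \<delta>2 where \<delta>2: "\<delta>2 > 0" "\<And>y. dist y x < \<delta>2 \<Longrightarrow> \<bar>dd u v y - dd u v x\<bar> < \<epsilon>/2"
      using lim[of "\<epsilon>/2" u v] eps by auto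
    define r where "r = min e (min \<delta>1 \<delta>2)"
    \<comment> \<open>The summand 1 keeps the quotient meaningful when \<open>u\<close> and
      \<open>v\<close> are both zero, and makes the bound \<open>hr\<close> strict.\<close>
    define h where "h = r / (norm u + norm v + 1)"
    have r: "r > 0" using e \<delta>1 \<delta>2 by (simp add: r_def)
    then have hpos: "h > 0" by (simp add: h_def add_nonneg_pos)
    have "h * (norm u + norm v + 1) = r"
      unfolding h_def by (simp add: add_nonneg_eq_0_iff)
    then have hr: "h * (norm u + norm v) < r"
      using hpos by (simp add: algebra_simps)
    have near: "dist (x + s *\<^sub>R a + t *\<^sub>R b) x < r"
      if "0 < s" "s < h" "0 < t" "t < h" "norm a + norm b = norm u + norm v" for s t a b
    proof -
      have "norm (s *\<^sub>R a + t *\<^sub>R b) \<le> s * norm a + t * norm b"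
        using norm_triangle_ineq[of "s *\<^sub>R a" "t *\<^sub>R b"] that by simp
      also have "\<dots> \<le> h * norm a + h * norm b"
        using that by (intro add_mono mult_right_mono) auto
      also have "\<dots> = h * (norm u + norm v)"
        using that(5) by (simp flip: distrib_left)
      finally show ?thesis using hr by (simp add: dist_norm add.assoc)
    qed
    obtain s t where st: "0 < s" "s < h" "0 < t" "t < h" "Q h v u = h * h * dd v u (x + s *\<^sub>R v + t *\<^sub>R u)"
      using key[of h v u] hpos hr by (auto simp: r_def add.commute)
    obtain s' t' where st': "0 < s'" "s' < h" "0 < t'" "t' < h" "Q h u v = h * h * dd u v (x + s' *\<^sub>R u + t' *\<^sub>R v)"
      using key[of h u v] hpos hr by (auto simp: r_def)
    have "Q h u v = Q h v u" by (simp add: Q_def algebra_simps)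
    then have "dd v u (x + s *\<^sub>R v + t *\<^sub>R u) = dd u v (x + s' *\<^sub>R u + t' *\<^sub>R v)"
      using st st' hpos by simp
    moreover have "\<bar>dd v u (x + s *\<^sub>R v + t *\<^sub>R u) - dd v u x\<bar> < \<epsilon>/2"
      using near[of s t v u] st by (intro \<delta>1) (auto simp: r_def)
    moreover have "\<bar>dd u v (x + s' *\<^sub>R u + t' *\<^sub>R v) - dd u v x\<bar> < \<epsilon>/2"
      using near[of s' t' u v] st' by (intro \<delta>2) (auto simp: r_def)
    ultimately show ?thesis by linarith
  qed
  then have "\<bar>dd v u x - dd u v x\<bar> \<le> 0"
    by (rule field_le_epsilon) simp
  then show ?thesis unfolding dd_def d_def by simp
qed


lemma frechet_derivative_inner:
  assumes "f differentiable at x"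
  shows "frechet_derivative (\<lambda>y. f y \<bullet> b) (at x) v = frechet_derivative f (at x) v \<bullet> b"
proof -
  have "((\<lambda>y. f y \<bullet> b) has_derivative (\<lambda>v. frechet_derivative f (at x) v \<bullet> b)) (at x)"
    using assms by (auto simp: frechet_derivative_works intro: has_derivative_inner_left)
  then show ?thesis by (simp flip: frechet_derivative_at)
qed

lemma second_derivative_symmetric:
  fixes f :: "'a::euclidean_space \<Rightarrow> 'b::euclidean_space"
  assumes "open U" "x \<in> U" "smooth_on U f"
  shows "frechet_derivative (\<lambda>y. frechet_derivative f (at y) v) (at x) u =
         frechet_derivative (\<lambda>y. frechet_derivative f (at y) u) (at x) v"
proof (rule euclidean_eqI)
  fix b :: 'b assume "b \<in> Basis"
  define g where "g y = f y \<bullet> b" for y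
  have eq: "frechet_derivative g (at y) w = frechet_derivative f (at y) w \<bullet> b" if "y \<in> U" for y w
    unfolding g_def using smooth_on_differentiable[OF assms(3) that] by (rule frechet_derivative_inner)
  have g: "smooth_on U g"
    unfolding g_def by (rule smooth_on_bounded_linear_compose[OF assms(1) bounded_linear_inner_left assms(3)])
  have eq2: "frechet_derivative (\<lambda>y. frechet_derivative f (at y) w) (at x) w' \<bullet> b =
      frechet_derivative (\<lambda>y. frechet_derivative g (at y) w) (at x) w'" for w w'
  proof -
    have "frechet_derivative (\<lambda>y. frechet_derivative g (at y) w) (at x) =
        frechet_derivative (\<lambda>y. frechet_derivative f (at y) w \<bullet> b) (at x)"
      using assms(1,2) eq smooth_on_differentiable[OF smooth_on_frechet[OF g] assms(2)]
      by (intro frechet_derivative_transform_within_open) auto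
    then show ?thesis
      using smooth_on_differentiable[OF smooth_on_frechet[OF assms(3)] assms(2)]
      by (simp add: frechet_derivative_inner)
  qed
  show "frechet_derivative (\<lambda>y. frechet_derivative f (at y) v) (at x) u \<bullet> b =
      frechet_derivative (\<lambda>y. frechet_derivative f (at y) u) (at x) v \<bullet> b"
    unfolding eq2 using assms(1,2) g by (intro second_derivative_symmetric_real) (auto simp only: smooth_on_def)
qed

text \<open>A product rule: one term moves the base point with the direction frozen at
  \<open>Y x\<close>, the other moves the direction.\<close>

lemma has_derivative_frechet_apply:
  fixes f :: "'a::euclidean_space \<Rightarrow> 'b::real_normed_vector"
  assumes U: "open U" "x \<in> U" and f: "smooth_on U f" and Y: "(Y has_derivative Y') (at x)"
  shows "((\<lambda>y. frechet_derivative f (at y) (Y y)) has_derivative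
     (\<lambda>w. frechet_derivative (\<lambda>y. frechet_derivative f (at y) (Y x)) (at x) w
        + frechet_derivative f (at x) (Y' w))) (at x)"
proof -
  define F where "F v y = frechet_derivative f (at y) v" for v y
  have F: "(F v has_derivative frechet_derivative (F v) (at x)) (at x)" for v
    using smooth_onD[OF smooth_on_frechet[OF f] U(2)] by (simp add: F_def[abs_def])
  have exp: "F v y = (\<Sum>b\<in>Basis. (v \<bullet> b) *\<^sub>R F b y)" if "y \<in> U" for v y
    unfolding F_def using smooth_on_frechet_linear[OF f that] by (rule linear_Basis_expansion)
  have *: "((\<lambda>y. \<Sum>b\<in>Basis. (Z y \<bullet> b) *\<^sub>R F b y) has_derivative
      (\<lambda>w. \<Sum>b\<in>Basis. (Z x \<bullet> b) *\<^sub>R frechet_derivative (F b) (at x) w + (Z' w \<bullet> b) *\<^sub>R F b x)) (at x)"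
    if "(Z has_derivative Z') (at x)" for Z Z'
    by (intro has_derivative_sum has_derivative_scaleR has_derivative_inner_left F that)
  have "(F (Y x) has_derivative (\<lambda>w. \<Sum>b\<in>Basis. (Y x \<bullet> b) *\<^sub>R frechet_derivative (F b) (at x) w)) (at x)"
    using has_derivative_transform_within_open[OF *[OF has_derivative_const] U, where g = "F (Y x)"] exp by simp
  then have "frechet_derivative (F (Y x)) (at x) w = (\<Sum>b\<in>Basis. (Y x \<bullet> b) *\<^sub>R frechet_derivative (F b) (at x) w)" for w
    by (simp flip: frechet_derivative_at)
  moreover have "((\<lambda>y. F (Y y) y) has_derivative
      (\<lambda>w. \<Sum>b\<in>Basis. (Y x \<bullet> b) *\<^sub>R frechet_derivative (F b) (at x) w + (Y' w \<bullet> b) *\<^sub>R F b x)) (at x)"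
    using has_derivative_transform_within_open[OF *[OF Y] U, where g = "\<lambda>y. F (Y y) y"] exp by simp
  ultimately have "((\<lambda>y. F (Y y) y) has_derivative
      (\<lambda>w. frechet_derivative (F (Y x)) (at x) w + F (Y' w) x)) (at x)"
    by (simp add: sum.distrib exp[OF U(2), of "Y' _"])
  then show ?thesis by (simp add: F_def[abs_def])
qed

section \<open>Derivatives along fields in Euclidean space\<close>

definition dir_deriv :: "('a::real_normed_vector \<Rightarrow> 'b::real_normed_vector) \<Rightarrow> ('a \<Rightarrow> 'a) \<Rightarrow> 'a \<Rightarrow> 'b" where
  "dir_deriv f X x = frechet_derivative f (at x) (X x)"

lemma smooth_on_dir_deriv:
  "open U \<Longrightarrow> smooth_on U f \<Longrightarrow> smooth_on U X \<Longrightarrow> smooth_on U (dir_deriv f X)"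
  using smooth_on_frechet_apply[of U "\<lambda>x. x" U f X] smooth_on_ident[of U]
  by (simp add: dir_deriv_def[abs_def])

lemma dir_deriv_dir_deriv:
  fixes f :: "'a::euclidean_space \<Rightarrow> 'b::real_normed_vector"
  assumes "open U" "x \<in> U" "smooth_on U f" "smooth_on U Y"
  shows "dir_deriv (dir_deriv f Y) X x =
    frechet_derivative (\<lambda>y. frechet_derivative f (at y) (Y x)) (at x) (X x)
    + frechet_derivative f (at x) (dir_deriv Y X x)"
  using frechet_derivative_at[OF has_derivative_frechet_apply[OF assms(1-3) smooth_onD[OF assms(4,2)]]]
  by (simp add: dir_deriv_def[abs_def] fun_eq_iff)

text \<open>The second-order terms cancel by symmetry. Allowing vector-valued \<open>f\<close> makes
  this the common source of the invariance of the bracket (\<open>f\<close> a transition map), of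
  the Jacobi identity (\<open>f\<close> a field) and of the action on functions.\<close>

lemma dir_deriv_commutator:
  fixes f :: "'a::euclidean_space \<Rightarrow> 'b::euclidean_space"
  assumes "open U" "x \<in> U" "smooth_on U f" "smooth_on U X" "smooth_on U Y"
  shows "dir_deriv (dir_deriv f Y) X x - dir_deriv (dir_deriv f X) Y x =
    frechet_derivative f (at x) (dir_deriv Y X x - dir_deriv X Y x)"
proof -
  have "frechet_derivative (\<lambda>y. frechet_derivative f (at y) (Y x)) (at x) (X x) =
      frechet_derivative (\<lambda>y. frechet_derivative f (at y) (X x)) (at x) (Y x)"
    by (rule second_derivative_symmetric[OF assms(1-3)])
  then show ?thesis
    using assms by (simp add: dir_deriv_dir_deriv linear_diff[OF smooth_on_frechet_linear[of U]])
qed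

lemma dir_deriv_diff:
  "f differentiable at x \<Longrightarrow> g differentiable at x \<Longrightarrow>
    dir_deriv (\<lambda>y. f y - g y) X x = dir_deriv f X x - dir_deriv g X x"
  using frechet_derivative_at[OF has_derivative_diff[of f "frechet_derivative f (at x)" "at x" g "frechet_derivative g (at x)"]]
  by (simp add: dir_deriv_def frechet_derivative_works fun_eq_iff)

lemma dir_deriv_jacobi:
  fixes X Y Z :: "'a::euclidean_space \<Rightarrow> 'a"
  assumes U: "open U" "x \<in> U" and sm: "smooth_on U X" "smooth_on U Y" "smooth_on U Z"
  defines "B \<equiv> \<lambda>X Y x. dir_deriv Y X x - dir_deriv X Y x"
  shows "B (B X Y) Z x + B (B Y Z) X x + B (B Z X) Y x = 0"
proof -
  \<comment> \<open>Each double bracket becomes four iterated derivatives; over the cyclic sum the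
    twelve terms cancel in pairs.\<close>
  have BB: "B (B X Y) Z x = dir_deriv (dir_deriv Z Y) X x - dir_deriv (dir_deriv Z X) Y x
      - (dir_deriv (dir_deriv Y X) Z x - dir_deriv (dir_deriv X Y) Z x)"
    if s: "smooth_on U X" "smooth_on U Y" "smooth_on U Z" for X Y Z :: "'a \<Rightarrow> 'a"
  proof -
    have "dir_deriv Z (B X Y) x = dir_deriv (dir_deriv Z Y) X x - dir_deriv (dir_deriv Z X) Y x"
      using dir_deriv_commutator[OF U s(3,1,2)] by (simp add: B_def dir_deriv_def)
    moreover have "dir_deriv (B X Y) Z x = dir_deriv (dir_deriv Y X) Z x - dir_deriv (dir_deriv X Y) Z x"
      unfolding B_def using s U
      by (intro dir_deriv_diff smooth_on_differentiable[of U] smooth_on_dir_deriv)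
    ultimately show ?thesis by (simp add: B_def)
  qed
  show ?thesis using sm by (simp add: BB)
qed

section \<open>Vector fields and their brackets\<close>

text \<open>The chart data on which calculus with fields depends, with no topology on the point set.
  It therefore covers both \<open>A\<close> and \<open>slit_atlas A\<close>, and the bundle need not
  be topologised.\<close>

locale smooth_atlas =
  fixes B :: "('a, 'e::euclidean_space) chart set"
  assumes chart_inj: "c \<in> B \<Longrightarrow> inj_on (snd c) (fst c)"
    and open_chart_image: "c \<in> B \<Longrightarrow> open (chart_image c)"
    and open_overlap: "c \<in> B \<Longrightarrow> c' \<in> B \<Longrightarrow> open (snd c ` (fst c \<inter> fst c'))"
    and smooth_transition:
      "c \<in> B \<Longrightarrow> c' \<in> B \<Longrightarrow> smooth_on (snd c ` (fst c \<inter> fst c')) (transition c c')"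

definition local_rep :: "('a, 'e::euclidean_space) vfield \<Rightarrow> ('a, 'e) chart \<Rightarrow> 'e \<Rightarrow> 'e" where
  "local_rep X c x = X (chart_inv c x) c"

lemma smooth_function_iff:
  "smooth_function B f \<longleftrightarrow> (\<forall>c\<in>B. smooth_on (chart_image c) (f \<circ> chart_inv c))"
  unfolding smooth_function_def Ck_function_def smooth_on_def by blast

lemma smooth_function_const: "smooth_function B (\<lambda>_. r)"
  by (simp add: smooth_function_iff comp_def smooth_on_const)

lemma tangent_space_0: "X p \<in> tangent_space B p \<Longrightarrow> \<not> (c \<in> B \<and> p \<in> fst c) \<Longrightarrow> X p c = 0"
  unfolding tangent_space_def by blast

lemma vector_fieldsD0: "X \<in> vector_fields B \<Longrightarrow> \<not> (c \<in> B \<and> p \<in> fst c) \<Longrightarrow> X p c = 0"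
  using tangent_space_0[of X p B c] by (simp add: vector_fields_def)

lemma vector_fieldsD_transform:
  "X \<in> vector_fields B \<Longrightarrow> c \<in> B \<Longrightarrow> c' \<in> B \<Longrightarrow> p \<in> fst c \<Longrightarrow> p \<in> fst c' \<Longrightarrow>
    X p c' = frechet_derivative (transition c c') (at (snd c p)) (X p c)"
  unfolding vector_fields_def tangent_space_def by blast

lemma vector_fieldsD_smooth:
  "X \<in> vector_fields B \<Longrightarrow> c \<in> B \<Longrightarrow> smooth_on (chart_image c) (local_rep X c)"
  by (auto simp: vector_fields_def local_rep_def[abs_def])

lemma vector_fieldsI:
  assumes "\<And>p c. \<not> (c \<in> B \<and> p \<in> fst c) \<Longrightarrow> X p c = 0"
    and "\<And>p c c'. c \<in> B \<Longrightarrow> c' \<in> B \<Longrightarrow> p \<in> fst c \<Longrightarrow> p \<in> fst c' \<Longrightarrow>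
      X p c' = frechet_derivative (transition c c') (at (snd c p)) (X p c)"
    and "\<And>c. c \<in> B \<Longrightarrow> smooth_on (chart_image c) (local_rep X c)"
  shows "X \<in> vector_fields B"
  unfolding vector_fields_def tangent_space_def mem_Collect_eq
proof (intro conjI allI ballI impI)
  show "X p c = 0" if "c \<notin> B \<or> p \<notin> fst c" for p c
    using that by (intro assms(1)) simp
  show "X p c' = frechet_derivative (transition c c') (at (snd c p)) (X p c)"
    if "c \<in> B" "c' \<in> B" "p \<in> fst c \<and> p \<in> fst c'" for p c c'
    using that by (intro assms(2)) simp_all
  show "smooth_on (chart_image c) (\<lambda>x. X (chart_inv c x) c)" if "c \<in> B" for c
    using assms(3)[OF that] by (simp add: local_rep_def[abs_def])
qed

lemma vector_field_eqI:
  assumes "X \<in> vector_fields B" "Y \<in> vector_fields B"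
    and "\<And>p c. c \<in> B \<Longrightarrow> p \<in> fst c \<Longrightarrow> X p c = Y p c"
  shows "X = Y"
proof (intro ext)
  fix p c show "X p c = Y p c"
    using assms vector_fieldsD0[of X B c p] vector_fieldsD0[of Y B c p]
    by (cases "c \<in> B \<and> p \<in> fst c") auto
qed

lemma local_rep_add: "local_rep (X + Y) c x = local_rep X c x + local_rep Y c x"
  and local_rep_minus: "local_rep (X - Y) c x = local_rep X c x - local_rep Y c x"
  and local_rep_uminus: "local_rep (- X) c x = - local_rep X c x"
  and local_rep_fscale: "local_rep (fscale f X) c x = f (chart_inv c x) *\<^sub>R local_rep X c x"
  by (simp_all add: local_rep_def fscale_def)

context smooth_atlas
begin

lemma chart_inv_left: "c \<in> B \<Longrightarrow> p \<in> fst c \<Longrightarrow> chart_inv c (snd c p) = p"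
  by (simp add: chart_inv_def chart_inj inv_into_f_f)

lemma chart_inv_right: "x \<in> chart_image c \<Longrightarrow> snd c (chart_inv c x) = x"
  by (simp add: chart_inv_def chart_image_def f_inv_into_f)

lemma chart_inv_in: "x \<in> chart_image c \<Longrightarrow> chart_inv c x \<in> fst c"
  by (simp add: chart_inv_def chart_image_def inv_into_into)

lemma chart_in: "p \<in> fst c \<Longrightarrow> snd c p \<in> chart_image c"
  by (simp add: chart_image_def)

lemma local_rep_at: "c \<in> B \<Longrightarrow> p \<in> fst c \<Longrightarrow> local_rep X c (snd c p) = X p c"
  by (simp add: local_rep_def chart_inv_left)

lemma transition_at: "c \<in> B \<Longrightarrow> p \<in> fst c \<Longrightarrow> transition c c' (snd c p) = snd c' p"
  by (simp add: transition_def chart_inv_left)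

lemma transition_differentiable:
  "c \<in> B \<Longrightarrow> c' \<in> B \<Longrightarrow> p \<in> fst c \<Longrightarrow> p \<in> fst c' \<Longrightarrow> transition c c' differentiable (at (snd c p))"
  using smooth_transition by (blast intro: smooth_on_differentiable)

lemma transition_linear:
  "c \<in> B \<Longrightarrow> c' \<in> B \<Longrightarrow> p \<in> fst c \<Longrightarrow> p \<in> fst c' \<Longrightarrow>
    linear (frechet_derivative (transition c c') (at (snd c p)))"
  by (simp add: transition_differentiable linear_frechet_derivative)

lemma frechet_transition_ident:
  assumes "c \<in> B" "p \<in> fst c"
  shows "frechet_derivative (transition c c) (at (snd c p)) = (\<lambda>v. v)"
proof -
  have "frechet_derivative (\<lambda>x. x) (at (snd c p)) = frechet_derivative (transition c c) (at (snd c p))"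
    using open_chart_image[OF assms(1)] chart_in[OF assms(2)]
    by (rule frechet_derivative_transform_within_open[rotated]) (auto simp: transition_def chart_inv_right)
  then show ?thesis by simp
qed

lemma frechet_transition_trans:
  assumes "c \<in> B" "c' \<in> B" "c'' \<in> B" "p \<in> fst c" "p \<in> fst c'" "p \<in> fst c''"
  shows "frechet_derivative (transition c c'') (at (snd c p)) v =
    frechet_derivative (transition c' c'') (at (snd c' p)) (frechet_derivative (transition c c') (at (snd c p)) v)"
proof -
  \<comment> \<open>Openness is available for pairwise overlaps, so the triple overlap is written as
    an intersection of two images; injectivity of the chart makes the two preimages of a point
    coincide.\<close>
  let ?O = "snd c ` (fst c \<inter> fst c') \<inter> snd c ` (fst c \<inter> fst c'')"
  have d: "transition c' c'' differentiable at (transition c c' (snd c p))"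
    using assms by (simp add: transition_at transition_differentiable)
  have "frechet_derivative (transition c' c'' \<circ> transition c c') (at (snd c p)) =
      frechet_derivative (transition c c'') (at (snd c p))"
  proof (rule frechet_derivative_transform_within_open)
    show "transition c' c'' \<circ> transition c c' differentiable at (snd c p)"
      using assms d by (intro differentiable_chain_at transition_differentiable) auto
    show "open ?O" using assms by (auto intro: open_overlap)
    show "snd c p \<in> ?O" using assms by auto
    show "(transition c' c'' \<circ> transition c c') x = transition c c'' x" if "x \<in> ?O" for x
    proof -
      from IntD1[OF that] obtain q where q: "x = snd c q" "q \<in> fst c" "q \<in> fst c'"
        by blast
      moreover from IntD2[OF that] obtain r where r: "x = snd c r" "r \<in> fst c" "r \<in> fst c''"
        by blast
      ultimately have "q = r"
        using inj_onD[OF chart_inj[OF assms(1)], of q r] by simp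
      then show ?thesis using q r assms by (simp add: transition_at)
    qed
  qed
  then show ?thesis
    using assms d fun_cong[OF frechet_derivative_compose[OF transition_differentiable d], of v]
    by (simp add: transition_at)
qed

lemma vector_fields_0: "0 \<in> vector_fields B"
proof (rule vector_fieldsI)
  show "smooth_on (chart_image c) (local_rep 0 c)" for c :: "('a, 'e) chart"
    by (simp add: local_rep_def[abs_def] smooth_on_const)
qed (simp_all add: linear_0[OF transition_linear])

lemma vector_fields_add:
  assumes "X \<in> vector_fields B" "Y \<in> vector_fields B"
  shows "X + Y \<in> vector_fields B"
proof (rule vector_fieldsI)
  show "smooth_on (chart_image c) (local_rep (X + Y) c)" if "c \<in> B" for c
    using assms that
    by (simp add: local_rep_add[abs_def] smooth_on_add open_chart_image vector_fieldsD_smooth)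
  show "(X + Y) p c' = frechet_derivative (transition c c') (at (snd c p)) ((X + Y) p c)"
    if "c \<in> B" "c' \<in> B" "p \<in> fst c" "p \<in> fst c'" for p c c'
    using that assms by (simp add: linear_add[OF transition_linear] vector_fieldsD_transform[of _ B c c'])
qed (simp add: vector_fieldsD0[OF assms(1)] vector_fieldsD0[OF assms(2)])

lemma vector_fields_fscale:
  assumes "X \<in> vector_fields B" "smooth_function B f"
  shows "fscale f X \<in> vector_fields B"
proof (rule vector_fieldsI)
  show "smooth_on (chart_image c) (local_rep (fscale f X) c)" if "c \<in> B" for c
  proof -
    have "smooth_on (chart_image c) (\<lambda>x. f (chart_inv c x))"
      using assms(2)[unfolded smooth_function_iff comp_def] that by (rule bspec)
    from smooth_on_scaleR[OF open_chart_image[OF that] this vector_fieldsD_smooth[OF assms(1) that]]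
    show ?thesis by (simp add: local_rep_fscale[abs_def])
  qed
  show "fscale f X p c' = frechet_derivative (transition c c') (at (snd c p)) (fscale f X p c)"
    if "c \<in> B" "c' \<in> B" "p \<in> fst c" "p \<in> fst c'" for p c c'
    using that assms by (simp add: linear_scale[OF transition_linear] vector_fieldsD_transform[of _ B c c'] fscale_def)
qed (simp add: vector_fieldsD0[OF assms(1)] fscale_def)

lemma vector_fields_scale: "X \<in> vector_fields B \<Longrightarrow> fscale (\<lambda>_. r) X \<in> vector_fields B"
  by (rule vector_fields_fscale[OF _ smooth_function_const])

lemma vector_fields_uminus:
  assumes "X \<in> vector_fields B"
  shows "- X \<in> vector_fields B"
proof -
  have "- X = fscale (\<lambda>_. - 1) X" by (simp add: fscale_def fun_eq_iff)
  then show ?thesis using assms by (simp add: vector_fields_scale)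
qed

lemma vector_fields_minus:
  "X \<in> vector_fields B \<Longrightarrow> Y \<in> vector_fields B \<Longrightarrow> X - Y \<in> vector_fields B"
  using vector_fields_add[of X "- Y"] vector_fields_uminus[of Y] by simp

lemma local_rep_differentiable:
  "X \<in> vector_fields B \<Longrightarrow> c \<in> B \<Longrightarrow> x \<in> chart_image c \<Longrightarrow> local_rep X c differentiable (at x)"
  by (blast intro: smooth_on_differentiable vector_fieldsD_smooth)

lemma lie_bracket_at:
  "c \<in> B \<Longrightarrow> p \<in> fst c \<Longrightarrow> lie_bracket B X Y p c =
    frechet_derivative (local_rep Y c) (at (snd c p)) (X p c)
    - frechet_derivative (local_rep X c) (at (snd c p)) (Y p c)"
  by (simp add: lie_bracket_def local_rep_def[abs_def])

lemma local_rep_lie_bracket: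
  assumes "c \<in> B" "x \<in> chart_image c"
  shows "local_rep (lie_bracket B X Y) c x =
    dir_deriv (local_rep Y c) (local_rep X c) x - dir_deriv (local_rep X c) (local_rep Y c) x"
  using lie_bracket_at[OF assms(1) chart_inv_in[OF assms(2)], of X Y] assms(2)
  by (simp add: local_rep_def dir_deriv_def chart_inv_right)

text \<open>Chain rule plus the transformation law of \<open>X\<close>: when \<open>f\<close> and
  \<open>g\<close> express the same map on the overlap, the derivative along \<open>X\<close> does
  not depend on the chart.\<close>

lemma dir_deriv_transition:
  assumes "X \<in> vector_fields B" "c \<in> B" "c' \<in> B" "p \<in> fst c" "p \<in> fst c'"
    and g: "g differentiable (at (snd c' p))"
    and eq: "\<And>q. q \<in> fst c \<Longrightarrow> q \<in> fst c' \<Longrightarrow> f (snd c q) = g (snd c' q)"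
  shows "dir_deriv g (local_rep X c') (snd c' p) = dir_deriv f (local_rep X c) (snd c p)"
proof -
  let ?O = "snd c ` (fst c \<inter> fst c')"
  have g': "g differentiable at (transition c c' (snd c p))"
    using g assms by (simp add: transition_at)
  have "frechet_derivative (g \<circ> transition c c') (at (snd c p)) = frechet_derivative f (at (snd c p))"
  proof (rule frechet_derivative_transform_within_open)
    show "g \<circ> transition c c' differentiable at (snd c p)"
      using assms g' by (intro differentiable_chain_at transition_differentiable) auto
    show "open ?O" using assms by (auto intro: open_overlap)
    show "snd c p \<in> ?O" using assms by auto
    show "(g \<circ> transition c c') x = f x" if "x \<in> ?O" for x
      using that assms by (auto simp: transition_at)
  qed
  from fun_cong[OF this] have "frechet_derivative f (at (snd c p)) v =
      frechet_derivative g (at (snd c' p)) (frechet_derivative (transition c c') (at (snd c p)) v)" for v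
    using assms(2-5) g' by (simp add: frechet_derivative_compose transition_differentiable transition_at)
  then show ?thesis
    using assms(1-5) by (simp add: dir_deriv_def local_rep_at vector_fieldsD_transform[of X B c c'])
qed

text \<open>The components of \<open>Y\<close> in a second chart are the derivative \<open>Y \<phi>\<close> of the transition map \<open>\<phi>\<close>,
  so the invariance of the bracket is the identity \<open>X (Y \<phi>) - Y (X \<phi>) = [X, Y] \<phi>\<close>.\<close>

lemma vector_fields_lie_bracket:
  assumes X: "X \<in> vector_fields B" and Y: "Y \<in> vector_fields B"
  shows "lie_bracket B X Y \<in> vector_fields B"
proof (rule vector_fieldsI)
  show "\<not> (c \<in> B \<and> p \<in> fst c) \<Longrightarrow> lie_bracket B X Y p c = 0" for p c
    by (auto simp: lie_bracket_def)
  show "smooth_on (chart_image c) (local_rep (lie_bracket B X Y) c)" if "c \<in> B" for c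
    using open_chart_image[OF that]
  proof (rule smooth_on_cong)
    show "smooth_on (chart_image c) (\<lambda>x. dir_deriv (local_rep Y c) (local_rep X c) x
        - dir_deriv (local_rep X c) (local_rep Y c) x)"
      using that X Y
      by (intro smooth_on_diff smooth_on_dir_deriv) (auto simp: open_chart_image vector_fieldsD_smooth)
  qed (simp add: that local_rep_lie_bracket)
  fix p c c' assume c: "c \<in> B" "c' \<in> B" "p \<in> fst c" "p \<in> fst c'"
  define \<phi> where "\<phi> = transition c c'"
  define U where "U = snd c ` (fst c \<inter> fst c')"
  have U: "open U" "snd c p \<in> U" "smooth_on U \<phi>" "U \<subseteq> chart_image c"
    using c unfolding U_def \<phi>_def chart_image_def
    by (auto simp only: intro!: open_overlap smooth_transition)
  have XY: "smooth_on U (local_rep Z c)" if "Z \<in> vector_fields B" for Z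
    using vector_fieldsD_smooth[OF that c(1)] U(4) by (rule smooth_on_subset)
  have rep: "dir_deriv (dir_deriv \<phi> (local_rep W c)) (local_rep Z c) (snd c p) =
      dir_deriv (local_rep W c') (local_rep Z c') (snd c' p)"
    if "Z \<in> vector_fields B" "W \<in> vector_fields B" for Z W
  proof (rule dir_deriv_transition[symmetric])
    show "dir_deriv \<phi> (local_rep W c) (snd c q) = local_rep W c' (snd c' q)"
      if "q \<in> fst c" "q \<in> fst c'" for q
      using c that \<open>W \<in> _\<close> by (simp add: dir_deriv_def \<phi>_def local_rep_at vector_fieldsD_transform[of W B c c'])
  qed (use that c in \<open>auto intro: local_rep_differentiable chart_in\<close>)
  have "lie_bracket B X Y p c' =
      dir_deriv (local_rep Y c') (local_rep X c') (snd c' p) - dir_deriv (local_rep X c') (local_rep Y c') (snd c' p)"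
    using local_rep_lie_bracket[of c' "snd c' p" X Y] c by (simp add: chart_in local_rep_at)
  also have "\<dots> = frechet_derivative \<phi> (at (snd c p))
      (dir_deriv (local_rep Y c) (local_rep X c) (snd c p) - dir_deriv (local_rep X c) (local_rep Y c) (snd c p))"
    using dir_deriv_commutator[OF U(1-3) XY[OF X] XY[OF Y]] X Y by (simp add: rep)
  also have "dir_deriv (local_rep Y c) (local_rep X c) (snd c p) - dir_deriv (local_rep X c) (local_rep Y c) (snd c p)
      = lie_bracket B X Y p c"
    using local_rep_lie_bracket[of c "snd c p" X Y] c by (simp add: chart_in local_rep_at)
  finally show "lie_bracket B X Y p c' = frechet_derivative (transition c c') (at (snd c p)) (lie_bracket B X Y p c)"
    by (simp add: \<phi>_def)
qed

lemmas vector_fields_closed =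
  vector_fields_0 vector_fields_add vector_fields_uminus vector_fields_minus vector_fields_scale
  vector_fields_lie_bracket

section \<open>The Lie algebra of vector fields\<close>

lemma lie_bracket_swap:
  assumes "X \<in> vector_fields B" "Y \<in> vector_fields B"
  shows "lie_bracket B Y X = - lie_bracket B X Y"
  using assms by (intro vector_field_eqI[of _ B]) (auto simp: vector_fields_closed lie_bracket_at)

lemma lie_bracket_add_right:
  assumes "X \<in> vector_fields B" "Y \<in> vector_fields B" "Z \<in> vector_fields B"
  shows "lie_bracket B X (Y + Z) = lie_bracket B X Y + lie_bracket B X Z"
proof (rule vector_field_eqI[of _ B])
  fix p c assume c: "c \<in> B" "p \<in> fst c"
  have "frechet_derivative (local_rep (Y + Z) c) (at (snd c p)) =
      (\<lambda>v. frechet_derivative (local_rep Y c) (at (snd c p)) v + frechet_derivative (local_rep Z c) (at (snd c p)) v)"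
    unfolding local_rep_add[abs_def] using assms c
    by (intro frechet_derivative_at[symmetric] has_derivative_add smooth_onD[OF vector_fieldsD_smooth])
      (auto intro: chart_in)
  moreover have "linear (frechet_derivative (local_rep X c) (at (snd c p)))"
    using assms(1) c by (intro linear_frechet_derivative local_rep_differentiable chart_in)
  ultimately show "lie_bracket B X (Y + Z) p c = (lie_bracket B X Y + lie_bracket B X Z) p c"
    using c by (simp add: lie_bracket_at linear_add)
qed (use assms in \<open>auto simp: vector_fields_closed\<close>)

lemma lie_bracket_add_left:
  assumes "X \<in> vector_fields B" "Y \<in> vector_fields B" "Z \<in> vector_fields B"
  shows "lie_bracket B (X + Y) Z = lie_bracket B X Z + lie_bracket B Y Z"
  using lie_bracket_add_right[of Z X Y] lie_bracket_swap[of Z] assms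
  by (simp add: vector_fields_closed)

lemma lie_bracket_minus_right:
  assumes "X \<in> vector_fields B" "Y \<in> vector_fields B" "Z \<in> vector_fields B"
  shows "lie_bracket B X (Y - Z) = lie_bracket B X Y - lie_bracket B X Z"
  using lie_bracket_add_right[of X "Y - Z" Z] assms by (simp add: vector_fields_closed)

lemma lie_bracket_minus_left:
  assumes "X \<in> vector_fields B" "Y \<in> vector_fields B" "Z \<in> vector_fields B"
  shows "lie_bracket B (X - Y) Z = lie_bracket B X Z - lie_bracket B Y Z"
  using lie_bracket_add_left[of "X - Y" Y Z] assms by (simp add: vector_fields_closed)

lemma lie_bracket_jacobi:
  assumes "X \<in> vector_fields B" "Y \<in> vector_fields B" "Z \<in> vector_fields B"
  shows "lie_bracket B (lie_bracket B X Y) Z + lie_bracket B (lie_bracket B Y Z) X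
    + lie_bracket B (lie_bracket B Z X) Y = 0"
proof (rule vector_field_eqI[of _ B])
  fix p c assume c: "c \<in> B" "p \<in> fst c"
  define br where "br u v x = dir_deriv v u x - dir_deriv u v x" for u v :: "'e \<Rightarrow> 'e" and x
  have brbr: "lie_bracket B (lie_bracket B U V) W p c =
      br (br (local_rep U c) (local_rep V c)) (local_rep W c) (snd c p)"
    if UVW: "U \<in> vector_fields B" "V \<in> vector_fields B" "W \<in> vector_fields B" for U V W
  proof -
    have "lie_bracket B (lie_bracket B U V) W p c =
        br (local_rep (lie_bracket B U V) c) (local_rep W c) (snd c p)"
      using local_rep_lie_bracket[OF c(1) chart_in[OF c(2)], of "lie_bracket B U V" W] c
      by (simp add: br_def local_rep_at)
    moreover have "local_rep (lie_bracket B U V) c x = br (local_rep U c) (local_rep V c) x"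
      if "x \<in> chart_image c" for x
      using local_rep_lie_bracket[OF c(1) that] by (simp add: br_def)
    \<comment> \<open>The bracket and its Euclidean expression agree only on the chart image;
      openness of that image allows differentiating once more.\<close>
    moreover from this have "frechet_derivative (local_rep (lie_bracket B U V) c) (at (snd c p)) =
        frechet_derivative (br (local_rep U c) (local_rep V c)) (at (snd c p))"
      using c UVW by (intro frechet_derivative_transform_within_open[of _ _ "chart_image c"])
        (auto intro: local_rep_differentiable chart_in open_chart_image vector_fields_lie_bracket)
    ultimately show ?thesis
      using c by (simp add: br_def[of "local_rep _ _"] br_def[of "br _ _"] dir_deriv_def chart_in)
  qed
  have "br (br (local_rep X c) (local_rep Y c)) (local_rep Z c) (snd c p)
      + br (br (local_rep Y c) (local_rep Z c)) (local_rep X c) (snd c p)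
      + br (br (local_rep Z c) (local_rep X c)) (local_rep Y c) (snd c p) = 0"
    unfolding br_def using assms c
    by (intro dir_deriv_jacobi[OF open_chart_image[OF c(1)] chart_in[OF c(2)]] vector_fieldsD_smooth)
  then show "(lie_bracket B (lie_bracket B X Y) Z + lie_bracket B (lie_bracket B Y Z) X
      + lie_bracket B (lie_bracket B Z X) Y) p c = 0 p c"
    using assms by (simp add: brbr)
qed (use assms in \<open>auto simp: vector_fields_closed\<close>)

section \<open>The action of vector fields on smooth functions\<close>

lemma vderiv_at:
  assumes "X \<in> vector_fields B" "smooth_function B f" "c \<in> B" "p \<in> fst c"
  shows "vderiv B X f p = dir_deriv (f \<circ> chart_inv c) (local_rep X c) (snd c p)"
proof -
  \<comment> \<open>The chart that \<open>SOME\<close> picks in \<open>vderiv\<close>; it is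
    exchanged for the given one by chart independence.\<close>
  define c' where "c' = (SOME c. c \<in> B \<and> p \<in> fst c)"
  have c': "c' \<in> B" "p \<in> fst c'"
    using someI[of "\<lambda>c. c \<in> B \<and> p \<in> fst c" c] assms by (auto simp: c'_def)
  have "vderiv B X f p = dir_deriv (f \<circ> chart_inv c') (local_rep X c') (snd c' p)"
    using c' by (simp add: vderiv_def dir_deriv_def local_rep_at flip: c'_def)
  also have "\<dots> = dir_deriv (f \<circ> chart_inv c) (local_rep X c) (snd c p)"
  proof (rule dir_deriv_transition[OF assms(1,3) c'(1) assms(4) c'(2)])
    show "f \<circ> chart_inv c' differentiable at (snd c' p)"
      using assms(2) c' by (auto simp: smooth_function_iff intro: smooth_on_differentiable chart_in)
  qed (use assms c' in \<open>simp add: chart_inv_left\<close>)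
  finally show ?thesis .
qed

lemma vderiv_chart_inv:
  assumes "X \<in> vector_fields B" "smooth_function B f" "c \<in> B" "x \<in> chart_image c"
  shows "(vderiv B X f \<circ> chart_inv c) x = dir_deriv (f \<circ> chart_inv c) (local_rep X c) x"
  using vderiv_at[OF assms(1-3) chart_inv_in[OF assms(4)]] assms(4) by (simp add: chart_inv_right)

lemma smooth_function_vderiv:
  assumes "X \<in> vector_fields B" "smooth_function B f"
  shows "smooth_function B (vderiv B X f)"
  unfolding smooth_function_iff
proof
  fix c assume c: "c \<in> B"
  show "smooth_on (chart_image c) (vderiv B X f \<circ> chart_inv c)"
    using open_chart_image[OF c]
  proof (rule smooth_on_cong)
    show "smooth_on (chart_image c) (dir_deriv (f \<circ> chart_inv c) (local_rep X c))"
      using assms c by (intro smooth_on_dir_deriv)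
        (auto simp: open_chart_image vector_fieldsD_smooth smooth_function_iff)
  qed (use assms c in \<open>simp add: vderiv_chart_inv[unfolded comp_def] comp_def\<close>)
qed

text \<open>Functions have arbitrary values off \<open>points B\<close>, and identities such as the
  homogeneity of \<open>E\<close> are known only on it. Since chart images are open, agreement there
  is enough to differentiate.\<close>

lemma vderiv_cong:
  assumes "p \<in> points B" "smooth_function B f" "\<And>q. q \<in> points B \<Longrightarrow> f q = g q" "X \<in> vector_fields B"
  shows "smooth_function B g" "vderiv B X f p = vderiv B X g p"
proof -
  have fg: "(f \<circ> chart_inv c) x = (g \<circ> chart_inv c) x" if "c \<in> B" "x \<in> chart_image c" for c x
    using that chart_inv_in[of x c] assms(3) by (auto simp: points_def)
  show g: "smooth_function B g"
    unfolding smooth_function_iff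
  proof
    fix c assume c: "c \<in> B"
    show "smooth_on (chart_image c) (g \<circ> chart_inv c)"
      using open_chart_image[OF c]
    proof (rule smooth_on_cong)
      show "smooth_on (chart_image c) (f \<circ> chart_inv c)"
        using assms(2) c by (simp add: smooth_function_iff)
    qed (rule fg[OF c])
  qed
  obtain c where c: "c \<in> B" "p \<in> fst c" using assms(1) by (auto simp: points_def)
  have "frechet_derivative (f \<circ> chart_inv c) (at (snd c p)) = frechet_derivative (g \<circ> chart_inv c) (at (snd c p))"
    using assms(2) c chart_in[OF c(2)] fg[OF c(1)] open_chart_image[OF c(1)]
    by (intro frechet_derivative_transform_within_open[of _ _ "chart_image c"])
      (auto simp: smooth_function_iff intro: smooth_on_differentiable)
  then show "vderiv B X f p = vderiv B X g p"
    using assms g c by (simp add: vderiv_at dir_deriv_def)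
qed

text \<open>Trades a bracket for a commutator of derivations; closedness of \<Omega>,
  \<open>i_J \<Omega> = 0\<close> and \<open>i_C \<Omega> = d_J E\<close> will be obtained from
  it.\<close>

lemma vderiv_lie_bracket:
  assumes "X \<in> vector_fields B" "Y \<in> vector_fields B" "smooth_function B f" "p \<in> points B"
  shows "vderiv B (lie_bracket B X Y) f p = vderiv B X (vderiv B Y f) p - vderiv B Y (vderiv B X f) p"
proof -
  obtain c where c: "c \<in> B" "p \<in> fst c" using assms(4) by (auto simp: points_def)
  define \<phi> where "\<phi> = f \<circ> chart_inv c"
  have \<phi>: "smooth_on (chart_image c) \<phi>" using assms(3) c by (simp add: smooth_function_iff \<phi>_def)
  have VV: "vderiv B V (vderiv B W f) p = dir_deriv (dir_deriv \<phi> (local_rep W c)) (local_rep V c) (snd c p)"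
    if VW: "V \<in> vector_fields B" "W \<in> vector_fields B" for V W
  proof -
    have "frechet_derivative (vderiv B W f \<circ> chart_inv c) (at (snd c p)) =
        frechet_derivative (dir_deriv \<phi> (local_rep W c)) (at (snd c p))"
    proof (rule frechet_derivative_transform_within_open[of _ _ "chart_image c"])
      show "vderiv B W f \<circ> chart_inv c differentiable at (snd c p)"
        using smooth_function_vderiv[OF VW(2) assms(3)] c
        by (auto simp: smooth_function_iff intro: smooth_on_differentiable chart_in)
    qed (use c VW assms(3) in \<open>auto simp: vderiv_chart_inv[unfolded comp_def] open_chart_image chart_in \<phi>_def comp_def\<close>)
    then show ?thesis
      using c VW assms(3) by (simp add: vderiv_at smooth_function_vderiv dir_deriv_def)
  qed
  have "vderiv B (lie_bracket B X Y) f p =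
      frechet_derivative \<phi> (at (snd c p)) (local_rep (lie_bracket B X Y) c (snd c p))"
    using assms c by (simp add: vderiv_at vector_fields_closed dir_deriv_def \<phi>_def)
  also have "local_rep (lie_bracket B X Y) c (snd c p) =
      dir_deriv (local_rep Y c) (local_rep X c) (snd c p) - dir_deriv (local_rep X c) (local_rep Y c) (snd c p)"
    using c by (simp add: local_rep_lie_bracket chart_in)
  also have "frechet_derivative \<phi> (at (snd c p)) \<dots> = vderiv B X (vderiv B Y f) p - vderiv B Y (vderiv B X f) p"
    using dir_deriv_commutator[OF open_chart_image[OF c(1)] chart_in[OF c(2)] \<phi>, of "local_rep X c" "local_rep Y c"]
      assms c by (simp add: VV vector_fieldsD_smooth)
  finally show ?thesis .
qed

lemma smooth_function_diff:
  assumes "smooth_function B f" "smooth_function B g"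
  shows "smooth_function B (\<lambda>p. f p - g p)"
  using assms unfolding smooth_function_iff comp_def by (auto intro: smooth_on_diff open_chart_image)

lemma vderiv_diff:
  assumes "X \<in> vector_fields B" "smooth_function B f" "smooth_function B g" "p \<in> points B"
  shows "vderiv B X (\<lambda>p. f p - g p) p = vderiv B X f p - vderiv B X g p"
proof -
  obtain c where c: "c \<in> B" "p \<in> fst c" using assms(4) by (auto simp: points_def)
  have "f \<circ> chart_inv c differentiable at (snd c p)" "g \<circ> chart_inv c differentiable at (snd c p)"
    using assms(2,3) c by (auto simp: smooth_function_iff intro: smooth_on_differentiable chart_in)
  from dir_deriv_diff[OF this, of "local_rep X c"] show ?thesis
    using assms c smooth_function_diff[OF assms(2,3)] by (simp add: vderiv_at comp_def)
qed

lemma vderiv_field_diff: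
  assumes "X \<in> vector_fields B" "Y \<in> vector_fields B" "smooth_function B f" "p \<in> points B"
  shows "vderiv B (X - Y) f p = vderiv B X f p - vderiv B Y f p"
proof -
  obtain c where c: "c \<in> B" "p \<in> fst c" using assms(4) by (auto simp: points_def)
  have "linear (frechet_derivative (f \<circ> chart_inv c) (at (snd c p)))"
    using assms(3) c by (auto simp: smooth_function_iff intro: smooth_on_frechet_linear chart_in)
  then show ?thesis
    using assms c by (simp add: vderiv_at vector_fields_closed dir_deriv_def local_rep_minus linear_diff)
qed

lemma vderiv_field_add:
  assumes "X \<in> vector_fields B" "Y \<in> vector_fields B" "smooth_function B f" "p \<in> points B"
  shows "vderiv B (X + Y) f p = vderiv B X f p + vderiv B Y f p"
  using vderiv_field_diff[of "X + Y" Y f p] assms by (simp add: vector_fields_closed)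

lemma vderiv_zero_field:
  assumes "smooth_function B f" "p \<in> points B"
  shows "vderiv B 0 f p = 0"
  using vderiv_field_diff[of 0 0 f p] assms by (simp add: vector_fields_closed)

lemma vderiv_zero:
  assumes "X \<in> vector_fields B" "p \<in> points B"
  shows "vderiv B X (\<lambda>_. 0) p = 0"
  using vderiv_diff[OF assms(1) smooth_function_const[of B 0] smooth_function_const[of B 0] assms(2)]
  by simp

lemma vderiv_uminus:
  assumes "X \<in> vector_fields B" "smooth_function B f" "p \<in> points B"
  shows "vderiv B X (\<lambda>p. - f p) p = - vderiv B X f p"
  using vderiv_diff[OF assms(1) smooth_function_const[of B 0] assms(2,3)] vderiv_zero[OF assms(1,3)]
  by simp

end

section \<open>The slit tangent bundle\<close>

text \<open>The topology of \<open>M\<close> is traded here for openness of overlaps: a chart is a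
  homeomorphism onto an open set, so it maps the relatively open overlap to an open set.\<close>

lemma smooth_atlas_manifold:
  assumes "smooth_manifold M A"
  shows "smooth_atlas A"
proof
  have chart: "openin M (fst c)" "open (chart_image c)"
    "homeomorphic_map (subtopology M (fst c)) (top_of_set (chart_image c)) (snd c)" if "c \<in> A" for c
    using assms that unfolding smooth_manifold_def by blast+
  have top: "topspace (subtopology M (fst c)) = fst c" if "c \<in> A" for c
    using openin_subset[OF chart(1)[OF that]] by (simp add: Int_absorb1)
  show "inj_on (snd c) (fst c)" if "c \<in> A" for c
    using homeomorphic_imp_injective_map[OF chart(3)[OF that]] top[OF that] by simp
  show "open (chart_image c)" if "c \<in> A" for c
    using chart(2)[OF that] .
  show "open (snd c ` (fst c \<inter> fst c'))" if c: "c \<in> A" "c' \<in> A" for c c'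
  proof -
    have "openin (subtopology M (fst c)) (fst c \<inter> fst c')"
      using chart(1)[OF c(2)] by (metis Int_commute openin_subtopology_Int)
    then have "openin (top_of_set (chart_image c)) (snd c ` (fst c \<inter> fst c'))"
      using homeomorphic_imp_open_map[OF chart(3)[OF c(1)]] by (simp add: open_map_def)
    then show ?thesis
      using chart(2)[OF c(1)] by (simp add: openin_open_eq)
  qed
  show "smooth_on (snd c ` (fst c \<inter> fst c')) (transition c c')" if "c \<in> A" "c' \<in> A" for c c'
    using assms that unfolding smooth_manifold_def by blast
qed

lemma points_slit_atlas: "points (slit_atlas A) = slit_bundle A"
  by (auto simp: points_def slit_atlas_def induced_chart_def slit_bundle_def tangent_bundle_def)

locale slit_manifold = base: smooth_atlas A for A :: "('m, real^'n::finite) chart set"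
begin

text \<open>The inverse of the component map \<open>v \<mapsto> v c\<close>. It identifies the fibre
  over \<open>p\<close> with the coordinate space, which yields both injectivity and the exact image
  of the induced charts.\<close>

definition tvec :: "('m, real^'n) chart \<Rightarrow> 'm \<Rightarrow> real^'n \<Rightarrow> ('m, real^'n) tvector" where
  "tvec c p y = (\<lambda>c'. if c' \<in> A \<and> p \<in> fst c'
     then frechet_derivative (transition c c') (at (snd c p)) y else 0)"

lemma tvec_in:
  assumes "c \<in> A" "p \<in> fst c"
  shows "tvec c p y \<in> tangent_space A p"
  unfolding tangent_space_def mem_Collect_eq
proof (intro conjI allI ballI impI)
  show "tvec c p y c' = 0" if "c' \<notin> A \<or> p \<notin> fst c'" for c'
    using that by (auto simp: tvec_def)
  show "tvec c p y c'' = frechet_derivative (transition c' c'') (at (snd c' p)) (tvec c p y c')"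
    if "c' \<in> A" "c'' \<in> A" "p \<in> fst c' \<and> p \<in> fst c''" for c' c''
    using base.frechet_transition_trans[OF assms(1) that(1,2) assms(2)] that by (simp add: tvec_def)
qed

lemma tvec_at: "c \<in> A \<Longrightarrow> p \<in> fst c \<Longrightarrow> tvec c p y c = y"
  by (simp add: tvec_def base.frechet_transition_ident)

lemma tangent_vector_transform:
  assumes "v \<in> tangent_space A p" "c \<in> A" "c' \<in> A" "p \<in> fst c" "p \<in> fst c'"
  shows "v c' = frechet_derivative (transition c c') (at (snd c p)) (v c)"
  using assms unfolding tangent_space_def by blast

lemma tangent_vector_eq_tvec:
  assumes "v \<in> tangent_space A p" "c \<in> A" "p \<in> fst c"
  shows "v = tvec c p (v c)"
proof
  fix c' show "v c' = tvec c p (v c) c'"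
  proof (cases "c' \<in> A \<and> p \<in> fst c'")
    case True
    then show ?thesis using tangent_vector_transform[OF assms(1,2), of c'] assms by (simp add: tvec_def)
  next
    case False
    then have "v c' = 0" using assms(1) unfolding tangent_space_def by blast
    then show ?thesis using False by (auto simp: tvec_def)
  qed
qed

lemma tvec_0: "c \<in> A \<Longrightarrow> p \<in> fst c \<Longrightarrow> tvec c p 0 = 0"
  by (rule ext) (simp add: tvec_def linear_0[OF base.transition_linear])

section \<open>Induced charts and their transition maps\<close>

abbreviation ind :: "('m, real^'n) chart \<Rightarrow> (('m, 'n) tm, (real^'n) \<times> (real^'n)) chart" where
  "ind c \<equiv> induced_chart (slit_bundle A) c"

lemma mem_ind: "c \<in> A \<Longrightarrow> z \<in> fst (ind c) \<longleftrightarrow>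
    fst z \<in> fst c \<and> snd z \<in> tangent_space A (fst z) \<and> snd z \<noteq> 0"
  by (auto simp: induced_chart_def slit_bundle_def tangent_bundle_def points_def)

lemma snd_ind: "snd (ind c) z = (snd c (fst z), snd z c)"
  by (simp add: induced_chart_def)

lemma ind_overlap_image:
  assumes "c \<in> A" "c' \<in> A"
  shows "snd (ind c) ` (fst (ind c) \<inter> fst (ind c')) = snd c ` (fst c \<inter> fst c') \<times> - {0}"
proof (intro equalityI subsetI)
  fix w assume "w \<in> snd (ind c) ` (fst (ind c) \<inter> fst (ind c'))"
  then obtain z where z: "w = snd (ind c) z" "z \<in> fst (ind c)" "z \<in> fst (ind c')" by blast
  \<comment> \<open>A vector with zero component in one chart is zero, so removing the zero section
    removes exactly \<open>0\<close> from each fibre coordinate.\<close>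
  have "snd z c \<noteq> 0"
  proof
    assume "snd z c = 0"
    then have "snd z = 0"
      using z(2) tangent_vector_eq_tvec[of "snd z" "fst z" c] tvec_0[of c "fst z"] assms(1)
      by (simp add: mem_ind)
    then show False using z(2) assms(1) by (simp add: mem_ind)
  qed
  then show "w \<in> snd c ` (fst c \<inter> fst c') \<times> - {0}"
    using z assms by (auto simp: mem_ind snd_ind)
next
  fix w :: "(real^'n) \<times> (real^'n)" assume w: "w \<in> snd c ` (fst c \<inter> fst c') \<times> - {0}"
  then have "fst w \<in> snd c ` (fst c \<inter> fst c')" "snd w \<noteq> 0" by auto
  then obtain p where p: "p \<in> fst c" "p \<in> fst c'" "fst w = snd c p" "snd w \<noteq> 0" by blast
  define z where "z = (p, tvec c p (snd w))"
  have "snd z c = snd w" using p(1) assms(1) by (simp add: z_def tvec_at)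
  then have "z \<in> fst (ind c)" "z \<in> fst (ind c')" "snd (ind c) z = w"
    using p assms by (auto simp: mem_ind snd_ind z_def tvec_in prod_eq_iff)
  then show "w \<in> snd (ind c) ` (fst (ind c) \<inter> fst (ind c'))" by blast
qed

lemma inj_on_ind:
  assumes "c \<in> A"
  shows "inj_on (snd (ind c)) (fst (ind c))"
proof (rule inj_onI)
  fix z w assume zw: "z \<in> fst (ind c)" "w \<in> fst (ind c)" "snd (ind c) z = snd (ind c) w"
  then have "fst z = fst w"
    using inj_onD[OF base.chart_inj[OF assms], of "fst z" "fst w"] assms by (simp add: mem_ind snd_ind)
  moreover have "snd z = snd w"
    using zw tangent_vector_eq_tvec[of "snd z" "fst z" c] tangent_vector_eq_tvec[of "snd w" "fst w" c]
      assms calculation by (simp add: mem_ind snd_ind)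
  ultimately show "z = w" by (rule prod_eqI)
qed

lemma transition_ind:
  assumes "c \<in> A" "c' \<in> A" "w \<in> snd c ` (fst c \<inter> fst c') \<times> - {0}"
  shows "transition (ind c) (ind c') w =
    (transition c c' (fst w), frechet_derivative (transition c c') (at (fst w)) (snd w))"
proof -
  obtain z where z: "w = snd (ind c) z" "z \<in> fst (ind c)" "z \<in> fst (ind c')"
    using assms(3) unfolding ind_overlap_image[OF assms(1,2), symmetric] by blast
  have "transition (ind c) (ind c') w = snd (ind c') z"
    using z inj_on_ind[OF assms(1)] by (simp add: transition_def chart_inv_def inv_into_f_f)
  moreover have "snd z c' = frechet_derivative (transition c c') (at (snd c (fst z))) (snd z c)"
    using z assms by (intro tangent_vector_transform) (simp_all add: mem_ind)
  ultimately show ?thesis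
    using z assms(1,2) by (simp add: snd_ind mem_ind base.transition_at)
qed

lemma open_ind_overlap:
  "c \<in> A \<Longrightarrow> c' \<in> A \<Longrightarrow> open (snd c ` (fst c \<inter> fst c') \<times> - {0 :: real^'n})"
  by (intro open_Times base.open_overlap) auto

lemma smooth_transition_ind:
  assumes "c \<in> A" "c' \<in> A"
  shows "smooth_on (snd c ` (fst c \<inter> fst c') \<times> - {0}) (transition (ind c) (ind c'))"
proof (rule smooth_on_cong[OF open_ind_overlap[OF assms] transition_ind[OF assms, symmetric]])
  let ?O = "snd c ` (fst c \<inter> fst c') \<times> - {0 :: real^'n}"
  have o: "open ?O" using assms by (rule open_ind_overlap)
  have f: "smooth_on ?O fst" and s: "smooth_on ?O snd"
    by (rule smooth_on_bounded_linear[OF o bounded_linear_fst],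
        rule smooth_on_bounded_linear[OF o bounded_linear_snd])
  have im: "fst ` ?O \<subseteq> snd c ` (fst c \<inter> fst c')" by auto
  note t = base.smooth_transition[OF assms]
  show "smooth_on ?O (\<lambda>w. (transition c c' (fst w), frechet_derivative (transition c c') (at (fst w)) (snd w)))"
    by (rule smooth_on_Pair[OF o smooth_on_compose[OF o im t f] smooth_on_frechet_apply[OF o im t f s]])
qed

sublocale slit: smooth_atlas "slit_atlas A"
proof
  fix d d' assume "d \<in> slit_atlas A" "d' \<in> slit_atlas A"
  then obtain c c' where c: "c \<in> A" "c' \<in> A" "d = ind c" "d' = ind c'"
    by (auto simp: slit_atlas_def)
  show "inj_on (snd d) (fst d)" using c by (simp add: inj_on_ind)
  show "open (chart_image d)"
    using ind_overlap_image[OF c(1,1)] open_ind_overlap[OF c(1,1)] c by (simp add: chart_image_def)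
  show "open (snd d ` (fst d \<inter> fst d'))"
    using ind_overlap_image[OF c(1,2)] open_ind_overlap[OF c(1,2)] c by simp
  show "smooth_on (snd d ` (fst d \<inter> fst d')) (transition d d')"
    using ind_overlap_image[OF c(1,2)] smooth_transition_ind[OF c(1,2)] c by simp
qed

text \<open>The transition is \<open>(x, y) \<mapsto> (\<phi> x, D\<phi>(x) y)\<close>, so its
  derivative is block triangular with \<open>\<Phi>\<close> twice on the diagonal. Looking only at
  the base component and at vertical vectors bypasses the block of second derivatives of
  \<open>\<phi>\<close>.\<close>

lemma
  assumes "c \<in> A" "c' \<in> A" "z \<in> fst (ind c)" "z \<in> fst (ind c')"
  defines "T \<equiv> frechet_derivative (transition (ind c) (ind c')) (at (snd (ind c) z))"
    and "\<Phi> \<equiv> frechet_derivative (transition c c') (at (snd c (fst z)))"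
  shows fst_frechet_transition_ind: "fst (T w) = \<Phi> (fst w)"
    and frechet_transition_ind_vertical: "T (0, b) = (0, \<Phi> b)"
proof -
  define U where "U = snd c ` (fst c \<inter> fst c') \<times> - {0 :: real^'n}"
  define x where "x = snd (ind c) z"
  have U: "open U" unfolding U_def by (rule open_ind_overlap[OF assms(1,2)])
  have xU: "x \<in> U"
    unfolding U_def ind_overlap_image[OF assms(1,2), symmetric] x_def using assms(3,4) by blast
  have fx: "fst x = snd c (fst z)" by (simp add: x_def snd_ind)
  have T: "(transition (ind c) (ind c') has_derivative T) (at x)"
    using smooth_onD[OF smooth_transition_ind[OF assms(1,2)], of x] xU by (simp add: U_def T_def x_def)
  have \<Phi>: "(transition c c' has_derivative \<Phi>) (at (fst x))"
    unfolding \<Phi>_def fx using assms(1-4)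
    by (simp add: base.transition_differentiable mem_ind flip: frechet_derivative_works)
  have t: "transition (ind c) (ind c') w = (transition c c' (fst w), frechet_derivative (transition c c') (at (fst w)) (snd w))"
    if "w \<in> U" for w
    using transition_ind[OF assms(1,2)] that by (simp add: U_def)
  have "((\<lambda>w. fst (transition (ind c) (ind c') w)) has_derivative (\<lambda>w. fst (T w))) (at x)"
    using T by (rule has_derivative_fst)
  moreover have "((\<lambda>w. fst (transition (ind c) (ind c') w)) has_derivative (\<lambda>w. \<Phi> (fst w))) (at x)"
  proof (rule has_derivative_transform_within_open[OF _ U xU])
    show "((\<lambda>w. transition c c' (fst w)) has_derivative (\<lambda>w. \<Phi> (fst w))) (at x)"
      using has_derivative_compose[OF has_derivative_fst[OF has_derivative_ident] \<Phi>] .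
  qed (simp add: t)
  ultimately have fst_T: "fst (T w) = \<Phi> (fst w)" for w
    using has_derivative_unique by (metis (mono_tags))
  then show "fst (T w) = \<Phi> (fst w)" .
  \<comment> \<open>Restricted to a fibre the transition is the linear map \<open>\<Phi>\<close>,
    hence its own derivative.\<close>
  have line: "((\<lambda>y. (fst x, y)) has_derivative (\<lambda>b. (0, b))) (at (snd x))"
    by (intro has_derivative_Pair has_derivative_const has_derivative_ident)
  have "((\<lambda>y. snd (transition (ind c) (ind c') (fst x, y))) has_derivative (\<lambda>b. snd (T (0, b)))) (at (snd x))"
    using has_derivative_compose[OF line has_derivative_snd] T by simp
  moreover have "((\<lambda>y. snd (transition (ind c) (ind c') (fst x, y))) has_derivative \<Phi>) (at (snd x))"
  proof (rule has_derivative_transform_within_open)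
    show "(\<Phi> has_derivative \<Phi>) (at (snd x))"
      using has_derivative_bounded_linear[OF \<Phi>] by (rule bounded_linear_imp_has_derivative)
    show "open (- {0 :: real^'n})" "snd x \<in> - {0}"
      using xU by (auto simp: U_def)
    show "\<Phi> y = snd (transition (ind c) (ind c') (fst x, y))" if "y \<in> - {0}" for y
    proof -
      have "(fst x, y) \<in> U"
        using xU that by (simp add: U_def mem_Times_iff)
      then show ?thesis by (simp add: t \<Phi>_def fx)
    qed
  qed
  ultimately have "snd (T (0, b)) = \<Phi> b"
    using has_derivative_unique by (metis (mono_tags))
  moreover have "\<Phi> 0 = 0"
    using linear_0[OF has_derivative_linear[OF \<Phi>]] .
  ultimately show "T (0, b) = (0, \<Phi> b)"
    by (simp add: prod_eq_iff fst_T)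
qed

section \<open>The almost tangent structure and the Liouville field in coordinates\<close>

lemma slit_chartE:
  assumes "d \<in> slit_atlas A"
  obtains c where "c \<in> A" "d = ind c"
  using assms by (auto simp: slit_atlas_def)

text \<open>Chart independence of \<open>J\<close> reflects the equality of the two diagonal blocks:
  base components transform exactly as vertical vectors do.\<close>

lemma J_closed:
  assumes X: "X \<in> VF A"
  shows "J X \<in> VF A"
proof (rule vector_fieldsI)
  show "J X z d = 0" if "\<not> (d \<in> slit_atlas A \<and> z \<in> fst d)" for z d
    using vector_fieldsD0[OF X that] by (simp add: J_def zero_prod_def)
  fix z d d' assume d: "d \<in> slit_atlas A" "d' \<in> slit_atlas A" "z \<in> fst d" "z \<in> fst d'"
  then obtain c c' where c: "c \<in> A" "c' \<in> A" "d = ind c" "d' = ind c'"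
    by (metis slit_chartE)
  show "J X z d' = frechet_derivative (transition d d') (at (snd d z)) (J X z d)"
    using vector_fieldsD_transform[OF X d] fst_frechet_transition_ind[of c c' z "X z d"]
      frechet_transition_ind_vertical[of c c' z "fst (X z d)"] c d
    by (simp add: J_def)
next
  fix d assume d: "d \<in> slit_atlas A"
  have "bounded_linear (\<lambda>w :: (real^'n) \<times> (real^'n). (0 :: real^'n, fst w))"
    by (intro bounded_linear_Pair bounded_linear_zero bounded_linear_fst)
  from smooth_on_bounded_linear_compose[OF slit.open_chart_image[OF d] this vector_fieldsD_smooth[OF X d]]
  show "smooth_on (chart_image d) (local_rep (J X) d)"
    by (simp add: local_rep_def[abs_def] J_def)
qed

lemma liouville_closed: "liouville A \<in> VF A"
proof (rule vector_fieldsI)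
  show "liouville A z d = 0" if "\<not> (d \<in> slit_atlas A \<and> z \<in> fst d)" for z d
    using that by (auto simp: liouville_def)
  fix z d d' assume d: "d \<in> slit_atlas A" "d' \<in> slit_atlas A" "z \<in> fst d" "z \<in> fst d'"
  then obtain c c' where c: "c \<in> A" "c' \<in> A" "d = ind c" "d' = ind c'"
    by (metis slit_chartE)
  have "snd z c' = frechet_derivative (transition c c') (at (snd c (fst z))) (snd z c)"
    using c d by (intro tangent_vector_transform) (simp_all add: mem_ind)
  then show "liouville A z d' = frechet_derivative (transition d d') (at (snd d z)) (liouville A z d)"
    using frechet_transition_ind_vertical[of c c' z "snd z c"] c d by (simp add: liouville_def snd_ind)
next
  fix d assume d: "d \<in> slit_atlas A"
  have "smooth_on (chart_image d) (\<lambda>w. (0 :: real^'n, snd w))"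
    by (intro smooth_on_bounded_linear slit.open_chart_image[OF d] bounded_linear_Pair
        bounded_linear_zero bounded_linear_snd)
  then show "smooth_on (chart_image d) (local_rep (liouville A) d)"
    by (rule smooth_on_cong[OF slit.open_chart_image[OF d], rotated])
      (simp add: local_rep_def liouville_def d slit.chart_inv_in slit.chart_inv_right)
qed

lemma frechet_local_rep_J:
  assumes "X \<in> VF A" "d \<in> slit_atlas A" "z \<in> fst d"
  shows "frechet_derivative (local_rep (J X) d) (at (snd d z)) w =
    (0, fst (frechet_derivative (local_rep X d) (at (snd d z)) w))"
proof -
  have "(local_rep X d has_derivative frechet_derivative (local_rep X d) (at (snd d z))) (at (snd d z))"
    using assms by (intro smooth_onD[OF vector_fieldsD_smooth] slit.chart_in)
  then have "((\<lambda>x. (0, fst (local_rep X d x))) has_derivative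
      (\<lambda>w. (0, fst (frechet_derivative (local_rep X d) (at (snd d z)) w)))) (at (snd d z))"
    by (intro has_derivative_Pair has_derivative_const has_derivative_fst)
  from fun_cong[OF frechet_derivative_at[OF this], of w] show ?thesis
    unfolding local_rep_def[abs_def] J_def by (rule sym)
qed

lemma frechet_local_rep_liouville:
  assumes "d \<in> slit_atlas A" "z \<in> fst d"
  shows "frechet_derivative (local_rep (liouville A) d) (at (snd d z)) w = (0, snd w)"
proof -
  have "((\<lambda>w. (0, snd w)) has_derivative (\<lambda>w. (0, snd w))) (at (snd d z))"
    by (intro has_derivative_Pair has_derivative_const has_derivative_snd has_derivative_ident)
  then have "(local_rep (liouville A) d has_derivative (\<lambda>w. (0, snd w))) (at (snd d z))"
    using slit.open_chart_image[OF assms(1)] slit.chart_in[OF assms(2)]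
    by (rule has_derivative_transform_within_open)
      (simp add: local_rep_def liouville_def assms(1) slit.chart_inv_in slit.chart_inv_right)
  from fun_cong[OF frechet_derivative_at[OF this], of w] show ?thesis by simp
qed

lemma J_add: "J (X + Y) = J X + J Y" for X Y :: "('m, 'n) tm_field"
  by (simp add: J_def fun_eq_iff prod_eq_iff)

lemma J_minus: "J (X - Y) = J X - J Y" for X Y :: "('m, 'n) tm_field"
  by (simp add: J_def fun_eq_iff prod_eq_iff)

lemma J_uminus: "J (- X) = - J X" for X :: "('m, 'n) tm_field"
  by (simp add: J_def fun_eq_iff prod_eq_iff)

lemma J_zero: "J 0 = (0 :: ('m, 'n) tm_field)"
  by (simp add: J_def fun_eq_iff prod_eq_iff)

lemma J_J: "J (J X) = (0 :: ('m, 'n) tm_field)"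
  by (simp add: J_def fun_eq_iff prod_eq_iff)

lemmas VF_closed = slit.vector_fields_closed J_closed liouville_closed

text \<open>The Nijenhuis torsion vanishes because \<open>J\<close> has constant coefficients in
  every induced chart; derivatives pass through \<open>J\<close>, and the terms with
  \<open>J\<close> applied twice disappear.\<close>

lemma J_nijenhuis:
  assumes "X \<in> VF A" "Y \<in> VF A"
  shows "br A (J X) (J Y) = J (br A (J X) Y) + J (br A X (J Y))"
proof (rule vector_field_eqI[of _ "slit_atlas A"])
  fix z d assume d: "d \<in> slit_atlas A" "z \<in> fst d"
  show "br A (J X) (J Y) z d = (J (br A (J X) Y) + J (br A X (J Y))) z d"
    using slit.lie_bracket_at[OF d] frechet_local_rep_J[OF assms(1) d] frechet_local_rep_J[OF assms(2) d]
    by (simp add: J_def prod_eq_iff)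
qed (use assms in \<open>auto intro!: VF_closed\<close>)

text \<open>The extra \<open>- J X\<close> is the derivative of the components \<open>(0, y)\<close>
  of the Liouville field in the direction \<open>J X\<close>.\<close>

lemma liouville_J:
  assumes "X \<in> VF A"
  shows "br A (liouville A) (J X) = J (br A (liouville A) X) - J X"
proof (rule vector_field_eqI[of _ "slit_atlas A"])
  fix z d assume d: "d \<in> slit_atlas A" "z \<in> fst d"
  show "br A (liouville A) (J X) z d = (J (br A (liouville A) X) - J X) z d"
    using slit.lie_bracket_at[OF d] frechet_local_rep_J[OF assms d] frechet_local_rep_liouville[OF d]
    by (simp add: J_def prod_eq_iff)
qed (use assms in \<open>auto intro!: VF_closed\<close>)

text \<open>The base component of \<open>S\<close> is \<open>y\<close>. Differentiating it along
  \<open>V\<close> returns the fibre component of \<open>V\<close>, while the base component of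
  \<open>V\<close> is identically zero and contributes nothing.\<close>

lemma J_bracket_vertical:
  assumes "V \<in> VF A" "J V = 0" "S \<in> VF A" "J S = liouville A"
  shows "J (br A V S) = V"
proof (rule vector_field_eqI[of _ "slit_atlas A"])
  fix z d assume d: "d \<in> slit_atlas A" "z \<in> fst d"
  have fV: "fst (V z d) = 0"
    using fun_cong[OF fun_cong[OF assms(2), of z], of d] by (simp add: J_def prod_eq_iff)
  have dV: "fst (frechet_derivative (local_rep V d) (at (snd d z)) w) = 0" for w
    using frechet_local_rep_J[OF assms(1) d, of w] assms(2)
    by (simp add: local_rep_def[abs_def] prod_eq_iff)
  have dS: "fst (frechet_derivative (local_rep S d) (at (snd d z)) w) = snd w" for w
    using frechet_local_rep_J[OF assms(3) d, of w] frechet_local_rep_liouville[OF d, of w] assms(4)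
    by simp
  show "J (br A V S) z d = V z d"
    using slit.lie_bracket_at[OF d] fV dV dS by (simp add: J_def prod_eq_iff)
qed (use assms in \<open>auto intro!: VF_closed\<close>)

end

section \<open>Finsler manifolds and the Barthel connection\<close>

text \<open>Avoids computing with the factor 1/2 in \<open>hproj\<close> and \<open>vproj\<close>:
  linear identities are proved for \<open>H X + H X = X + G X\<close> and then halved.\<close>

lemma double_cancel:
  fixes X Y :: "('a, 'e::euclidean_space) vfield"
  assumes "X + X = Y + Y"
  shows "X = Y"
proof (intro ext)
  fix p c
  have "X p c + X p c = Y p c + Y p c"
    using fun_cong[OF fun_cong[OF assms, of p], of c] by simp
  then show "X p c = Y p c" by (simp flip: scaleR_2)
qed

lemma fscale_half: "fscale (\<lambda>_. 1/2) X + fscale (\<lambda>_. 1/2) X = X"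
  by (simp add: fun_eq_iff fscale_def flip: scaleR_add_left)

lemma fscale_minus_half: "fscale (\<lambda>_. - 1/2) (X + X) = - X"
  by (simp add: fun_eq_iff fscale_def flip: scaleR_2)

locale finsler_spray = slit_manifold A for A :: "('m, real^'n::finite) chart set" +
  fixes E :: "('m, 'n) tm \<Rightarrow> real" and S :: "('m, 'n) tm_field"
  assumes smooth_E: "smooth_function (slit_atlas A) E"
    and homogeneous: "z \<in> slit_bundle A \<Longrightarrow> der A (liouville A) E z = 2 * E z"
    and nondegenerate: "z \<in> slit_bundle A \<Longrightarrow> X \<in> VF A \<Longrightarrow> X z \<noteq> 0 \<Longrightarrow> \<exists>Y\<in>VF A. Omega A E X Y z \<noteq> 0"
    and spray: "canonical_spray A E S"
begin

declare VF_closed [simp]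

lemma S_closed [simp]: "S \<in> VF A"
  using spray by (simp add: canonical_spray_def)

lemma lie_bracket_zero_left: "X \<in> VF A \<Longrightarrow> br A 0 X = 0"
  using slit.lie_bracket_minus_left[of X X X] by simp

lemmas br_linear = slit.lie_bracket_add_left slit.lie_bracket_add_right
  slit.lie_bracket_minus_left slit.lie_bracket_minus_right lie_bracket_zero_left

section \<open>The fundamental two-form\<close>

lemma smooth_dJ [simp]: "X \<in> VF A \<Longrightarrow> smooth_function (slit_atlas A) (dJ A E X)"
  by (simp add: dJ_def[abs_def] slit.smooth_function_vderiv smooth_E)

lemma dJ_minus:
  "X \<in> VF A \<Longrightarrow> Y \<in> VF A \<Longrightarrow> z \<in> slit_bundle A \<Longrightarrow> dJ A E (X - Y) z = dJ A E X z - dJ A E Y z"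
  by (simp add: dJ_def J_minus slit.vderiv_field_diff smooth_E points_slit_atlas)

lemma dJ_add:
  "X \<in> VF A \<Longrightarrow> Y \<in> VF A \<Longrightarrow> z \<in> slit_bundle A \<Longrightarrow> dJ A E (X + Y) z = dJ A E X z + dJ A E Y z"
  by (simp add: dJ_def J_add slit.vderiv_field_add smooth_E points_slit_atlas)

lemma dJ_zero: "z \<in> slit_bundle A \<Longrightarrow> dJ A E 0 z = 0"
  by (simp add: dJ_def J_zero slit.vderiv_zero_field smooth_E points_slit_atlas)

lemma dJ_J: "z \<in> slit_bundle A \<Longrightarrow> dJ A E (J X) z = 0"
  by (simp add: dJ_def J_J slit.vderiv_zero_field smooth_E points_slit_atlas)

lemma Omega_eq:
  "Omega A E X Y z = der A X (dJ A E Y) z - der A Y (dJ A E X) z - dJ A E (br A X Y) z"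
  by (simp add: Omega_def ext_deriv1_def)

lemma smooth_Omega [simp]:
  "X \<in> VF A \<Longrightarrow> Y \<in> VF A \<Longrightarrow> smooth_function (slit_atlas A) (Omega A E X Y)"
  unfolding Omega_eq[abs_def]
  by (intro slit.smooth_function_diff slit.smooth_function_vderiv smooth_dJ) simp_all

lemma Omega_swap:
  assumes "X \<in> VF A" "Y \<in> VF A" "z \<in> slit_bundle A"
  shows "Omega A E Y X z = - Omega A E X Y z"
proof -
  have "dJ A E (br A Y X) z = - dJ A E (br A X Y) z"
    using slit.lie_bracket_swap[OF assms(1,2)] dJ_minus[of 0 "br A X Y" z] assms
    by (simp add: dJ_zero)
  then show ?thesis by (simp add: Omega_eq)
qed

lemma Omega_minus_left:
  assumes "X \<in> VF A" "Y \<in> VF A" "Z \<in> VF A" "z \<in> slit_bundle A"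
  shows "Omega A E (X - Y) Z z = Omega A E X Z z - Omega A E Y Z z"
proof -
  have "der A Z (dJ A E (X - Y)) z = der A Z (\<lambda>q. dJ A E X q - dJ A E Y q) z"
    using assms by (intro slit.vderiv_cong(2)) (simp_all add: points_slit_atlas dJ_minus)
  also have "\<dots> = der A Z (dJ A E X) z - der A Z (dJ A E Y) z"
    using assms by (simp add: slit.vderiv_diff points_slit_atlas)
  finally show ?thesis
    using assms by (simp add: Omega_eq slit.vderiv_field_diff points_slit_atlas br_linear dJ_minus)
qed

lemma Omega_minus_right:
  assumes "X \<in> VF A" "Y \<in> VF A" "Z \<in> VF A" "z \<in> slit_bundle A"
  shows "Omega A E Z (X - Y) z = Omega A E Z X z - Omega A E Z Y z"
  using Omega_minus_left[OF assms] Omega_swap[of Z _ z] assms by simp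

lemma Omega_zero_left: "X \<in> VF A \<Longrightarrow> z \<in> slit_bundle A \<Longrightarrow> Omega A E 0 X z = 0"
  using Omega_minus_left[of 0 0 X z] by simp

lemma Omega_zero_right: "X \<in> VF A \<Longrightarrow> z \<in> slit_bundle A \<Longrightarrow> Omega A E X 0 z = 0"
  using Omega_minus_right[of 0 0 X z] by simp

lemma Omega_nondegenerate:
  assumes "X \<in> VF A" "\<And>Y z. Y \<in> VF A \<Longrightarrow> z \<in> slit_bundle A \<Longrightarrow> Omega A E X Y z = 0"
  shows "X = 0"
proof (rule vector_field_eqI[OF assms(1)])
  fix z d assume "d \<in> slit_atlas A" "z \<in> fst d"
  then have "z \<in> slit_bundle A" by (auto simp: points_def simp flip: points_slit_atlas)
  then have "X z = 0" using nondegenerate[of z X] assms by blast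
  then show "X z d = 0 z d" by simp
qed simp

text \<open>\<open>d d = 0\<close> for the form \<open>d_J E\<close>: brackets acting on functions
  expand into commutators, and the remaining double brackets cancel by the Jacobi identity.\<close>

lemma Omega_closed:
  assumes XYZ: "X \<in> VF A" "Y \<in> VF A" "Z \<in> VF A" and z: "z \<in> slit_bundle A"
  shows "der A X (Omega A E Y Z) z + der A Y (Omega A E Z X) z + der A Z (Omega A E X Y) z
    = Omega A E (br A X Y) Z z + Omega A E (br A Y Z) X z + Omega A E (br A Z X) Y z"
proof -
  have d: "der A X (Omega A E Y Z) z = der A X (der A Y (dJ A E Z)) z - der A X (der A Z (dJ A E Y)) z
      - der A X (dJ A E (br A Y Z)) z"
    if "X \<in> VF A" "Y \<in> VF A" "Z \<in> VF A" for X Y Z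
    unfolding Omega_eq[abs_def] using that z
    by (simp add: slit.vderiv_diff slit.smooth_function_diff slit.smooth_function_vderiv points_slit_atlas)
  have b: "Omega A E (br A X Y) Z z = der A X (der A Y (dJ A E Z)) z - der A Y (der A X (dJ A E Z)) z
      - der A Z (dJ A E (br A X Y)) z - dJ A E (br A (br A X Y) Z) z"
    if "X \<in> VF A" "Y \<in> VF A" "Z \<in> VF A" for X Y Z
    using that z by (simp add: Omega_eq slit.vderiv_lie_bracket points_slit_atlas)
  have "dJ A E (br A (br A X Y) Z) z + dJ A E (br A (br A Y Z) X) z + dJ A E (br A (br A Z X) Y) z
      = dJ A E (br A (br A X Y) Z + br A (br A Y Z) X + br A (br A Z X) Y) z"
    using XYZ z by (simp add: dJ_add)
  also have "\<dots> = 0"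
    using slit.lie_bracket_jacobi[OF XYZ] z by (simp add: dJ_zero)
  finally show ?thesis using XYZ by (simp add: d b)
qed

lemma der_dJ_J:
  assumes "X \<in> VF A" "Y \<in> VF A" "z \<in> slit_bundle A"
  shows "der A Y (dJ A E (J X)) z = 0"
proof -
  have "der A Y (dJ A E (J X)) z = der A Y (\<lambda>_. 0) z"
    using assms by (intro slit.vderiv_cong(2)) (simp_all add: points_slit_atlas dJ_J)
  then show ?thesis
    using assms(2,3) by (simp add: slit.vderiv_zero points_slit_atlas)
qed

text \<open>\<open>[J X, J Y] E\<close> is evaluated twice, as a commutator of derivations and
  through the vanishing Nijenhuis torsion. Consequently \<Omega> vanishes on vertical pairs and
  gives a symmetric form on vertical fields.\<close>

lemma Omega_J:
  assumes XY: "X \<in> VF A" "Y \<in> VF A" and z: "z \<in> slit_bundle A"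
  shows "Omega A E (J X) Y z = - Omega A E X (J Y) z"
proof -
  have "der A (br A (J X) (J Y)) E z = dJ A E (br A (J X) Y) z + dJ A E (br A X (J Y)) z"
    using assms by (simp add: J_nijenhuis dJ_def slit.vderiv_field_add smooth_E points_slit_atlas)
  moreover have "der A (br A (J X) (J Y)) E z = der A (J X) (dJ A E Y) z - der A (J Y) (dJ A E X) z"
    using assms slit.vderiv_lie_bracket[of "J X" "J Y" E z]
    by (simp add: dJ_def[abs_def] smooth_E points_slit_atlas)
  ultimately show ?thesis
    using assms by (simp add: Omega_eq der_dJ_J)
qed

lemma Omega_vertical_swap:
  assumes "X \<in> VF A" "Y \<in> VF A" "z \<in> slit_bundle A"
  shows "Omega A E (J X) Y z = Omega A E (J Y) X z"
  using Omega_J[OF assms] Omega_swap[of X "J Y" z] assms by simp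

text \<open>Evaluate \<open>[C, J X] E\<close> in two ways: homogeneity of \<open>E\<close>
  contributes \<open>2 d_J E\<close>, the commutation rule of \<open>C\<close> with \<open>J\<close>
  takes one copy away.\<close>

lemma Omega_liouville:
  assumes X: "X \<in> VF A" and z: "z \<in> slit_bundle A"
  shows "Omega A E (liouville A) X z = dJ A E X z"
proof -
  let ?C = "liouville A"
  have JC: "J ?C = 0"
    by (auto simp: J_def liouville_def fun_eq_iff zero_prod_def)
  have "der A X (dJ A E ?C) z = der A X (dJ A E (J 0)) z"
    by (simp add: dJ_def[abs_def] JC J_J)
  then have "der A X (dJ A E ?C) z = 0"
    using der_dJ_J[of 0 X z] X z by simp
  moreover have "der A (br A ?C (J X)) E z = dJ A E (br A ?C X) z - dJ A E X z"
    using X z by (simp add: liouville_J dJ_def slit.vderiv_field_diff smooth_E points_slit_atlas)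
  moreover have "der A (br A ?C (J X)) E z = der A ?C (dJ A E X) z - der A (J X) (der A ?C E) z"
    using X z slit.vderiv_lie_bracket[of ?C "J X" E z]
    by (simp add: dJ_def[abs_def] smooth_E points_slit_atlas)
  moreover have "der A (J X) (der A ?C E) z = 2 * dJ A E X z"
  proof -
    \<comment> \<open>Homogeneity is used as \<open>E = C E - E\<close> on the slit bundle, so the
      difference rule suffices to differentiate it.\<close>
    have "der A (J X) E z = der A (J X) (\<lambda>q. der A ?C E q - E q) z"
      using X z by (intro slit.vderiv_cong(2)) (simp_all add: points_slit_atlas homogeneous smooth_E)
    also have "\<dots> = der A (J X) (der A ?C E) z - der A (J X) E z"
      using X z by (simp add: slit.vderiv_diff slit.smooth_function_vderiv smooth_E points_slit_atlas)
    finally show ?thesis by (simp add: dJ_def)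
  qed
  ultimately show ?thesis by (simp add: Omega_eq)
qed

lemma J_spray: "J S = liouville A"
proof -
  have "J S - liouville A = 0"
  proof (rule Omega_nondegenerate)
    fix X z assume X: "X \<in> VF A" and z: "z \<in> slit_bundle A"
    have "Omega A E (J S) X z = dJ A E X z"
      using Omega_J[of S X z] spray X z by (simp add: canonical_spray_def dJ_def)
    then show "Omega A E (J S - liouville A) X z = 0"
      using X z by (simp add: Omega_minus_left Omega_liouville)
  qed simp
  then show ?thesis by simp
qed

section \<open>The Barthel connection, its projectors and its curvature\<close>

abbreviation G :: "('m, 'n) tm_field \<Rightarrow> ('m, 'n) tm_field" where "G \<equiv> barthel A S"
abbreviation H :: "('m, 'n) tm_field \<Rightarrow> ('m, 'n) tm_field" where "H \<equiv> hproj A S"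

lemma G_eq: "G X = br A (J X) S - J (br A X S)"
  by (simp add: barthel_def FN_bracket10_def)

lemma G_closed [simp]: "X \<in> VF A \<Longrightarrow> G X \<in> VF A"
  by (simp add: G_eq)

lemma H_closed [simp]: "X \<in> VF A \<Longrightarrow> H X \<in> VF A"
  by (simp add: hproj_def)

lemma H_double: "H X + H X = X + G X"
  by (simp add: hproj_def fscale_half)

lemma vproj_eq: "vproj A S X = X - H X"
proof (rule double_cancel)
  have "vproj A S X + vproj A S X = X - G X"
    by (simp add: vproj_def fscale_half)
  also have "\<dots> = (X + X) - (H X + H X)" by (simp add: H_double)
  finally show "vproj A S X + vproj A S X = (X - H X) + (X - H X)" by simp
qed

lemma G_minus: "X \<in> VF A \<Longrightarrow> Y \<in> VF A \<Longrightarrow> G (X - Y) = G X - G Y"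
  by (simp add: G_eq J_minus br_linear)

lemma H_minus:
  assumes "X \<in> VF A" "Y \<in> VF A"
  shows "H (X - Y) = H X - H Y"
proof (rule double_cancel)
  have "H (X - Y) + H (X - Y) = (X + G X) - (Y + G Y)"
    using assms by (simp add: H_double G_minus)
  also have "\<dots> = (H X + H X) - (H Y + H Y)" by (simp only: H_double)
  finally show "H (X - Y) + H (X - Y) = (H X - H Y) + (H X - H Y)" by simp
qed

lemma H_add: "X \<in> VF A \<Longrightarrow> Y \<in> VF A \<Longrightarrow> H (X + Y) = H X + H Y"
  using H_minus[of "X + Y" Y] by simp

lemma J_vertical_bracket: "V \<in> VF A \<Longrightarrow> J V = 0 \<Longrightarrow> J (br A V S) = V"
  by (simp add: J_bracket_vertical J_spray)

text \<open>Both this and \<open>G_vertical\<close> are instances of \<open>J [V, S] = V\<close>,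
  with \<open>V = J X\<close> and with \<open>V\<close> itself. They make \<open>H\<close> a
  projector whose kernel is the vertical fields.\<close>

lemma J_G: "X \<in> VF A \<Longrightarrow> J (G X) = J X"
  by (simp add: G_eq J_minus J_J J_vertical_bracket)

lemma G_vertical: "V \<in> VF A \<Longrightarrow> J V = 0 \<Longrightarrow> G V = - V"
  by (simp add: G_eq lie_bracket_zero_left J_vertical_bracket)

lemma J_H: "X \<in> VF A \<Longrightarrow> J (H X) = J X"
  by (rule double_cancel) (simp add: H_double J_G flip: J_add, simp add: J_add J_G)

lemma H_vertical: "V \<in> VF A \<Longrightarrow> J V = 0 \<Longrightarrow> H V = 0"
  by (rule double_cancel) (simp add: H_double G_vertical)

lemma H_J: "X \<in> VF A \<Longrightarrow> H (J X) = 0"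
  by (simp add: H_vertical J_J)

lemma H_H: "X \<in> VF A \<Longrightarrow> H (H X) = H X"
  using H_vertical[of "X - H X"] by (simp add: J_minus J_H H_minus)

lemma G_H: "X \<in> VF A \<Longrightarrow> G (H X) = H X"
  using H_double[of "H X"] by (simp add: H_H)

text \<open>Integrability of the vertical bundle: with \<open>V = J [V, S]\<close> and
  \<open>W = J [W, S]\<close>, the Nijenhuis identity puts \<open>[V, W]\<close> in the image of
  \<open>J\<close>.\<close>

lemma J_bracket_of_vertical:
  assumes "V \<in> VF A" "J V = 0" "W \<in> VF A" "J W = 0"
  shows "J (br A V W) = 0"
  using J_nijenhuis[of "br A V S" "br A W S"] assms by (simp add: J_vertical_bracket J_add J_J)

lemma bracket_derivation:
  assumes "X \<in> VF A" "Y \<in> VF A"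
  shows "br A (br A X Y) S = br A (br A X S) Y + br A X (br A Y S)"
proof -
  have "br A (br A S X) Y = - br A (br A X S) Y"
    using slit.lie_bracket_swap[of X S] slit.lie_bracket_minus_left[of 0 "br A X S" Y] assms
    by (simp add: lie_bracket_zero_left)
  moreover have "br A (br A Y S) X = - br A X (br A Y S)"
    using slit.lie_bracket_swap[of X "br A Y S"] assms by simp
  ultimately have "br A (br A X Y) S - br A X (br A Y S) - br A (br A X S) Y = 0"
    using slit.lie_bracket_jacobi[of X Y S] assms by simp
  then show ?thesis by (simp only: diff_eq_eq add_0)
qed

text \<open>\<open>[J, \<Gamma>] = 0\<close>: differentiate the vanishing Nijenhuis torsion of \<open>J\<close> along \<open>S\<close>.\<close>

lemma J_G_bracket:
  assumes XY: "X \<in> VF A" "Y \<in> VF A"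
  shows "br A (G X) (J Y) + br A (J X) (G Y) =
    G (br A (J X) Y + br A X (J Y)) + J (br A (G X) Y) + J (br A X (G Y))"
proof -
  have "br A (J (br A (J X) Y) + J (br A X (J Y))) S = br A (br A (J X) (J Y)) S"
    using XY by (simp add: J_nijenhuis)
  also have "\<dots> = br A (br A (J X) S) (J Y) + br A (J X) (br A (J Y) S)"
    using XY by (simp add: bracket_derivation)
  finally have 1: "br A (J (br A (J X) Y)) S + br A (J (br A X (J Y))) S =
      br A (br A (J X) S) (J Y) + br A (J X) (br A (J Y) S)"
    using XY by (simp add: br_linear)
  \<comment> \<open>These remove the parts \<open>J [X, S]\<close> and \<open>J [Y, S]\<close> of
    \<open>G X\<close> and \<open>G Y\<close> from the brackets; fact 1 accounts for the other
    parts.\<close>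
  have 2: "br A (J (br A X S)) (J Y) = J (br A (J (br A X S)) Y) + J (br A (br A X S) (J Y))"
    "br A (J X) (J (br A Y S)) = J (br A (J X) (br A Y S)) + J (br A X (J (br A Y S)))"
    using XY by (simp_all add: J_nijenhuis)
  show ?thesis
    using XY 1 2 by (simp add: G_eq br_linear bracket_derivation J_add J_minus algebra_simps)
qed

text \<open>The identity \<open>[J, \<Gamma>] = 0\<close> at horizontal arguments, where
  \<open>G\<close> is the identity and \<open>J H = J\<close>: it reads
  \<open>W - G W = 2 J [H X, H Y]\<close>, and \<open>W - G W\<close> is twice the vertical part of
  \<open>W\<close>.\<close>

lemma horizontal_torsion:
  assumes "X \<in> VF A" "Y \<in> VF A"
  defines "W \<equiv> br A (H X) (J Y) - br A (H Y) (J X)"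
  shows "W - H W = J (br A (H X) (H Y))"
proof (rule double_cancel)
  have W: "W \<in> VF A" "W = br A (J (H X)) (H Y) + br A (H X) (J (H Y))"
    using assms slit.lie_bracket_swap[of "H Y" "J X"] by (simp_all add: W_def J_H)
  have "W = G W + J (br A (H X) (H Y)) + J (br A (H X) (H Y))"
    using J_G_bracket[of "H X" "H Y"] assms(1,2) by (simp add: G_H flip: W(2)) (simp add: W(2) add.commute)
  then have "(W + W) - (W + G W) = J (br A (H X) (H Y)) + J (br A (H X) (H Y))"
    by (simp add: algebra_simps)
  then show "W - H W + (W - H W) = J (br A (H X) (H Y)) + J (br A (H X) (H Y))"
    unfolding H_double[symmetric] by (simp add: algebra_simps)
qed

text \<open>The bracket of two vertical parts is vertical, so
  \<open>H [X - H X, Y - H Y] = 0\<close>; this removes the arguments that are not projected from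
  the Froelicher-Nijenhuis bracket and leaves \<open>- v [H X, H Y]\<close>.\<close>

lemma curvature_eq:
  assumes XY: "X \<in> VF A" "Y \<in> VF A"
  shows "curvature A S X Y = H (br A (H X) (H Y)) - br A (H X) (H Y)"
proof -
  define K where "K = br A (H X) (H Y) + H (br A X Y) - H (br A (H X) Y) - H (br A X (H Y))"
  have "FN_bracket11 (slit_atlas A) H H X Y = K + K"
    using XY by (simp add: FN_bracket11_def K_def H_H)
  then have "curvature A S X Y = - K"
    unfolding curvature_def by (simp only: fscale_minus_half)
  moreover have "H (br A (X - H X) (Y - H Y)) = 0"
    using XY by (intro H_vertical J_bracket_of_vertical) (simp_all add: J_minus J_H)
  then have "H (br A X Y) - H (br A (H X) Y) - H (br A X (H Y)) + H (br A (H X) (H Y)) = 0"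
    using XY by (simp add: br_linear H_minus H_add algebra_simps)
  then have "K = br A (H X) (H Y) - H (br A (H X) (H Y))"
    by (simp add: K_def algebra_simps eq_neg_iff_add_eq_0)
  ultimately show ?thesis by simp
qed

section \<open>The vertical metric\<close>

lemma vmetric_J:
  assumes "X \<in> VF A" "Y \<in> VF A" "z \<in> slit_bundle A"
  shows "vmetric A E (J X) (J Y) z = Omega A E (J X) Y z"
proof -
  define Y' where "Y' = (SOME Z. Z \<in> VF A \<and> J Z = J Y)"
  have Y': "Y' \<in> VF A" "J Y' = J Y"
    using someI[of "\<lambda>Z. Z \<in> VF A \<and> J Z = J Y" Y] assms(2) by (simp_all add: Y'_def)
  \<comment> \<open>Moving \<open>J\<close> across shows that the value depends on \<open>Y'\<close>
    only through \<open>J Y'\<close>, so the choice made by \<open>SOME\<close> is harmless.\<close>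
  have "Omega A E (J X) Y' z = Omega A E (J X) Y z"
    using Y' assms by (simp add: Omega_J)
  then show ?thesis by (simp add: vmetric_def Y'_def)
qed

lemma metric_J:
  assumes "X \<in> VF A" "Y \<in> VF A" "z \<in> slit_bundle A"
  shows "metric A E S (J X) (J Y) z = Omega A E (J X) Y z"
proof -
  have "vmetric A E (J (J X)) (J (J Y)) z = 0"
    using vmetric_J[of "J X" "J Y" z] assms by (simp add: J_J Omega_zero_left)
  then show ?thesis
    using assms by (simp add: metric_def vproj_eq H_J vmetric_J)
qed


text \<open>This is \<open>d\<Omega> = 0\<close> on \<open>(J X, J Y, Z)\<close>. The derivative
  along \<open>Z\<close> drops out, and the rest says that the Lie derivative of the vertical metric
  along \<open>J X\<close> at \<open>(Y, Z)\<close> is symmetric in \<open>X\<close> and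
  \<open>Y\<close>.\<close>

lemma Omega_cyclic:
  assumes XYZ: "X \<in> VF A" "Y \<in> VF A" "Z \<in> VF A" and z: "z \<in> slit_bundle A"
  shows "der A (J X) (Omega A E (J Y) Z) z - Omega A E (J (br A (J X) Y)) Z z - Omega A E (J Y) (br A (J X) Z) z
    = der A (J Y) (Omega A E (J X) Z) z - Omega A E (J (br A (J Y) X)) Z z - Omega A E (J X) (br A (J Y) Z) z"
proof -
  have zero: "Omega A E (J U) (J W) q = 0" if "U \<in> VF A" "W \<in> VF A" "q \<in> slit_bundle A" for U W q
    using that by (simp add: Omega_J J_J Omega_zero_right)
  have "der A Z (Omega A E (J X) (J Y)) z = der A Z (\<lambda>_. 0) z"
    using XYZ z by (intro slit.vderiv_cong(2)) (simp_all add: points_slit_atlas zero)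
  then have 1: "der A Z (Omega A E (J X) (J Y)) z = 0"
    using XYZ(3) z by (simp add: slit.vderiv_zero points_slit_atlas)
  have "der A (J Y) (Omega A E Z (J X)) z = der A (J Y) (\<lambda>q. - Omega A E (J X) Z q) z"
    using XYZ z by (intro slit.vderiv_cong(2)) (simp_all add: points_slit_atlas Omega_swap[of "J X" Z])
  then have 2: "der A (J Y) (Omega A E Z (J X)) z = - der A (J Y) (Omega A E (J X) Z) z"
    using XYZ z by (simp add: slit.vderiv_uminus points_slit_atlas)
  \<comment> \<open>The Nijenhuis identity splits the vertical bracket into one term for each
    side.\<close>
  have 3: "Omega A E (br A (J X) (J Y)) Z z =
      Omega A E (J (br A (J X) Y)) Z z - Omega A E (J (br A (J Y) X)) Z z"
  proof -
    have "br A X (J Y) = - br A (J Y) X"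
      using XYZ slit.lie_bracket_swap[of "J Y" X] by simp
    then have "br A (J X) (J Y) = J (br A (J X) Y) - J (br A (J Y) X)"
      using XYZ by (simp add: J_nijenhuis J_uminus)
    then show ?thesis using XYZ z by (simp add: Omega_minus_left)
  qed
  have 4: "Omega A E (br A (J Y) Z) (J X) z = - Omega A E (J X) (br A (J Y) Z) z"
    using XYZ z by (simp add: Omega_swap[of "J X"])
  have 5: "Omega A E (br A Z (J X)) (J Y) z = Omega A E (J Y) (br A (J X) Z) z"
  proof -
    have "br A Z (J X) = 0 - br A (J X) Z"
      using XYZ slit.lie_bracket_swap[of "J X" Z] by simp
    then have "Omega A E (br A Z (J X)) (J Y) z = - Omega A E (br A (J X) Z) (J Y) z"
      using XYZ z by (simp only: Omega_minus_left VF_closed Omega_zero_left)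
    then show ?thesis
      using XYZ z by (simp add: Omega_swap[of "J Y"])
  qed
  show ?thesis
    using Omega_closed[of "J X" "J Y" Z z] XYZ z unfolding 1 2 3 4 5 by simp
qed

end

section \<open>The Hashiguchi connection\<close>

locale hashiguchi = finsler_spray A E S
  for A :: "('m, real^'n::finite) chart set" and E :: "('m, 'n) tm \<Rightarrow> real" and S :: "('m, 'n) tm_field" +
  fixes D :: "('m, 'n) tm_field \<Rightarrow> ('m, 'n) tm_field \<Rightarrow> ('m, 'n) tm_field"
  assumes connection: "hashiguchi_connection A E S D"
begin

abbreviation T :: "('m, 'n) tm_field \<Rightarrow> ('m, 'n) tm_field \<Rightarrow> ('m, 'n) tm_field" where
  "T \<equiv> torsion (slit_atlas A) D"

lemma D_closed [simp]: "X \<in> VF A \<Longrightarrow> Y \<in> VF A \<Longrightarrow> D X Y \<in> VF A"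
  using connection unfolding hashiguchi_connection_def linear_connection_def vector_1form_def by blast

lemma D_add_right:
  "X \<in> VF A \<Longrightarrow> Y \<in> VF A \<Longrightarrow> Z \<in> VF A \<Longrightarrow> D X (Y + Z) = D X Y + D X Z"
  using connection unfolding hashiguchi_connection_def linear_connection_def by blast

lemma D_J: "X \<in> VF A \<Longrightarrow> Y \<in> VF A \<Longrightarrow> D X (J Y) = J (D X Y)"
  using connection unfolding hashiguchi_connection_def lift_of_barthel_def by blast

lemma D_G: "X \<in> VF A \<Longrightarrow> Y \<in> VF A \<Longrightarrow> D X (G Y) = G (D X Y)"
  using connection unfolding hashiguchi_connection_def lift_of_barthel_def by blast

lemma D_H:
  assumes "X \<in> VF A" "Y \<in> VF A"
  shows "D X (H Y) = H (D X Y)"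
proof (rule double_cancel)
  have "D X (H Y) + D X (H Y) = D X (H Y + H Y)"
    using assms by (simp add: D_add_right)
  also have "\<dots> = D X (Y + G Y)" by (simp only: H_double)
  also have "\<dots> = D X Y + G (D X Y)" using assms by (simp add: D_add_right D_G)
  finally show "D X (H Y) + D X (H Y) = H (D X Y) + H (D X Y)" by (simp only: H_double)
qed

lemma T_closed [simp]: "X \<in> VF A \<Longrightarrow> Y \<in> VF A \<Longrightarrow> T X Y \<in> VF A"
  by (simp add: torsion_def)

lemma T_vertical: "X \<in> VF A \<Longrightarrow> Y \<in> VF A \<Longrightarrow> D (J X) (J Y) - D (J Y) (J X) = br A (J X) (J Y)"
  using connection unfolding hashiguchi_connection_def torsion_def by simp

lemma T_mixed: "X \<in> VF A \<Longrightarrow> Y \<in> VF A \<Longrightarrow> T (H X) (J Y) = H (T (H X) (J Y))"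
  using connection unfolding hashiguchi_connection_def by (simp add: vproj_eq)

lemma D_metric:
  "X \<in> VF A \<Longrightarrow> Y \<in> VF A \<Longrightarrow> Z \<in> VF A \<Longrightarrow> z \<in> slit_bundle A \<Longrightarrow>
    der A (J X) (metric A E S Y Z) z = metric A E S (D (J X) Y) Z z + metric A E S Y (D (J X) Z) z"
  using connection unfolding hashiguchi_connection_def by blast

text \<open>In \<open>T (H X) (J Y)\<close> the derivative \<open>D (J Y) (H X)\<close> is
  horizontal and \<open>D (H X) (J Y)\<close> is vertical, so vanishing of the vertical part
  determines the latter.\<close>

lemma J_D_horizontal:
  assumes "X \<in> VF A" "Y \<in> VF A"
  shows "J (D (H X) Y) = br A (H X) (J Y) - H (br A (H X) (J Y))"
proof -
  have 1: "H (T (H X) (J Y)) = - D (J Y) (H X) - H (br A (H X) (J Y))"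
    using assms by (simp add: torsion_def H_minus D_J D_H H_J H_H)
  have 2: "T (H X) (J Y) = J (D (H X) Y) - D (J Y) (H X) - br A (H X) (J Y)"
    using assms by (simp add: torsion_def D_J)
  show ?thesis
    using trans[OF 2[symmetric] trans[OF T_mixed[OF assms] 1]] by (simp add: algebra_simps)
qed

lemma T_horizontal:
  assumes "X \<in> VF A" "Y \<in> VF A"
  shows "T (H X) (H Y) = curvature A S X Y"
proof -
  let ?W = "\<lambda>X Y. br A (H X) (J Y)"
  have "J (T (H X) (H Y)) = (?W X Y - H (?W X Y)) - (?W Y X - H (?W Y X)) - J (br A (H X) (H Y))"
    using assms by (simp add: torsion_def J_minus D_H J_H J_D_horizontal)
  also have "\<dots> = (?W X Y - ?W Y X - H (?W X Y - ?W Y X)) - J (br A (H X) (H Y))"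
    using assms by (simp add: H_minus)
  also have "\<dots> = 0"
    using horizontal_torsion[OF assms] by simp
  finally have "H (T (H X) (H Y)) = 0"
    using assms by (simp add: H_vertical)
  then have "T (H X) (H Y) = T (H X) (H Y) - H (T (H X) (H Y))" by simp
  \<comment> \<open>\<open>D\<close> commutes with \<open>H\<close>, so both covariant derivatives
    are horizontal and only the bracket survives.\<close>
  also have "\<dots> = H (br A (H X) (H Y)) - br A (H X) (H Y)"
    using assms by (simp add: torsion_def H_minus D_H H_H)
  finally show ?thesis using assms by (simp add: curvature_eq)
qed

text \<open>Covariant minus Lie derivative along \<open>J X\<close>. Its image under
  \<open>J\<close> will be the Cartan tensor, and its horizontal part is what \<open>F\<close> makes
  of that tensor.\<close>

definition Q :: "('m, 'n) tm_field \<Rightarrow> ('m, 'n) tm_field \<Rightarrow> ('m, 'n) tm_field" where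
  "Q X Y = D (J X) Y - br A (J X) Y"

lemma Q_closed [simp]: "X \<in> VF A \<Longrightarrow> Y \<in> VF A \<Longrightarrow> Q X Y \<in> VF A"
  by (simp add: Q_def)

lemma J_Q_sym:
  assumes "X \<in> VF A" "Y \<in> VF A"
  shows "J (Q X Y) = J (Q Y X)"
proof -
  have "br A X (J Y) = - br A (J Y) X"
    using assms slit.lie_bracket_swap[of "J Y" X] by simp
  then have "J (D (J X) Y) - J (D (J Y) X) = J (br A (J X) Y) - J (br A (J Y) X)"
    using T_vertical[OF assms] assms by (simp add: D_J J_nijenhuis J_uminus)
  then show ?thesis by (simp add: Q_def J_minus algebra_simps)
qed

text \<open>The Koszul trick: the trilinear form \<open>t X Y Z = \<Omega>(J (Q X Y), Z)\<close> is symmetric in \<open>X, Y\<close> because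
  \<open>D\<close> has no vertical torsion, while \<open>t X Y Z + t X Z Y\<close>, the Lie derivative of the vertical metric,
  is symmetric in \<open>X, Y\<close> because \<open>\<Omega>\<close> is closed; together this makes \<open>t\<close> totally symmetric.\<close>

lemma lie_deriv_vertical_metric:
  assumes XYZ: "X \<in> VF A" "Y \<in> VF A" "Z \<in> VF A" and z: "z \<in> slit_bundle A"
  shows "lie_deriv2 (slit_atlas A) (J X) (\<lambda>Y Z. metric A E S (J Y) (J Z)) Y Z z =
    2 * Omega A E (J (Q X Y)) Z z"
proof -
  define t where "t X Y Z = Omega A E (J (Q X Y)) Z z" for X Y Z
  define c where "c X Y Z = der A (J X) (Omega A E (J Y) Z) z
    - Omega A E (J (br A (J X) Y)) Z z - Omega A E (J Y) (br A (J X) Z) z" for X Y Z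
  have der_metric: "der A (J X) (metric A E S (J Y) (J Z)) z = der A (J X) (Omega A E (J Y) Z) z"
    if "X \<in> VF A" "Y \<in> VF A" "Z \<in> VF A" for X Y Z
    using that z by (intro slit.vderiv_cong(2)[symmetric]) (simp_all add: points_slit_atlas metric_J)
  have ct: "c X Y Z = t X Y Z + t X Z Y" if s: "X \<in> VF A" "Y \<in> VF A" "Z \<in> VF A" for X Y Z
  proof -
    \<comment> \<open>Metricity along \<open>J X\<close>; subtracting the bracket terms of
      \<open>c\<close> converts each covariant derivative into a \<open>Q\<close>.\<close>
    have "der A (J X) (Omega A E (J Y) Z) z =
        Omega A E (J (D (J X) Y)) Z z + Omega A E (J Y) (D (J X) Z) z"
      using D_metric[of X "J Y" "J Z" z] s z by (simp add: der_metric D_J metric_J)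
    moreover have "t X Y Z = Omega A E (J (D (J X) Y)) Z z - Omega A E (J (br A (J X) Y)) Z z"
      using s z by (simp add: t_def Q_def J_minus Omega_minus_left)
    moreover have "t X Z Y = Omega A E (J Y) (Q X Z) z"
      using s z by (simp add: t_def Omega_vertical_swap)
    then have "t X Z Y = Omega A E (J Y) (D (J X) Z) z - Omega A E (J Y) (br A (J X) Z) z"
      using s z by (simp add: Q_def Omega_minus_right)
    ultimately show ?thesis by (simp add: c_def)
  qed
  have c_sym: "c X Y Z = c Y X Z" if "X \<in> VF A" "Y \<in> VF A" "Z \<in> VF A" for X Y Z
    using Omega_cyclic[OF that z] by (simp add: c_def)
  have t12: "t X Y Z = t Y X Z" if "X \<in> VF A" "Y \<in> VF A" "Z \<in> VF A" for X Y Z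
    using that by (simp add: t_def J_Q_sym[of X Y])
  have "t X Z Y = t Y Z X"
    using c_sym[OF XYZ] t12[OF XYZ] ct[OF XYZ] ct[OF XYZ(2,1,3)] by simp
  moreover have "t Z X Y = t Y X Z"
    using c_sym[OF XYZ(3,2,1)] t12[OF XYZ(3,2,1)] ct[OF XYZ(3,2,1)] ct[OF XYZ(2,3,1)] by simp
  \<comment> \<open>The chain is \<open>t X Z Y = t Z X Y = t Y X Z = t X Y Z\<close>; the two
    summands of \<open>c\<close> then agree, which gives the factor 2.\<close>
  ultimately have "t X Z Y = t X Y Z"
    using t12[OF XYZ] t12[OF XYZ(1,3,2)] by simp
  moreover have "lie_deriv2 (slit_atlas A) (J X) (\<lambda>Y Z. metric A E S (J Y) (J Z)) Y Z z = c X Y Z"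
    using XYZ z by (simp add: lie_deriv2_def c_def der_metric metric_J)
  ultimately show ?thesis using ct[OF XYZ] by (simp add: t_def)
qed

text \<open>Both fields have the same pairing with every \<open>Z\<close>: the 1/2 in the definition
  of the tensor cancels the 2 just found, and nondegeneracy concludes.\<close>

lemma cartan_tensor_eq:
  assumes C: "first_cartan_tensor A E S C" and XY: "X \<in> VF A" "Y \<in> VF A"
  shows "C X Y = J (Q X Y)"
proof -
  have CXY: "C X Y \<in> VF A"
    using C XY unfolding first_cartan_tensor_def vector_1form_def by blast
  have "C X Y - J (Q X Y) = 0"
  proof (rule Omega_nondegenerate)
    fix Z z assume Z: "Z \<in> VF A" and z: "z \<in> slit_bundle A"
    have "Omega A E (C X Y) Z z =
        1/2 * lie_deriv2 (slit_atlas A) (J X) (\<lambda>Y Z. metric A E S (J Y) (J Z)) Y Z z"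
      using C XY Z z unfolding first_cartan_tensor_def by blast
    then show "Omega A E (C X Y - J (Q X Y)) Z z = 0"
      using CXY XY Z z by (simp add: Omega_minus_left lie_deriv_vertical_metric)
  qed (use CXY XY in simp)
  then show ?thesis by simp
qed

lemma T_mixed_eq:
  assumes C: "first_cartan_tensor A E S C" and F: "almost_complex_structure A S F"
    and XY: "X \<in> VF A" "Y \<in> VF A"
  shows "T (H X) (J Y) = - F (C X Y)"
proof -
  \<comment> \<open>The vertical part of \<open>X\<close> does not affect \<open>J [X, J Y]\<close>,
    so \<open>H X\<close> may be replaced by \<open>X\<close>.\<close>
  have "J (br A (X - H X) (J Y)) = 0"
    using XY by (intro J_bracket_of_vertical) (simp_all add: J_minus J_H J_J)
  then have "J (br A (H X) (J Y)) = J (br A X (J Y))"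
    using XY by (simp add: br_linear J_minus)
  moreover have "br A X (J Y) = - br A (J Y) X"
    using XY slit.lie_bracket_swap[of "J Y" X] by simp
  \<comment> \<open>The arguments of \<open>Q\<close> come out interchanged, and the symmetry of
    \<open>J (Q X Y)\<close> restores the order.\<close>
  ultimately have "J (T (H X) (J Y)) = - J (Q Y X)"
    using XY by (simp add: torsion_def Q_def J_minus J_uminus D_J D_H J_H J_J)
  then have "J (T (H X) (J Y) + Q X Y) = 0"
    using J_Q_sym[OF XY] by (simp add: J_add)
  then have "H (T (H X) (J Y) + Q X Y) = 0"
    using XY by (intro H_vertical) simp_all
  then have "T (H X) (J Y) + H (Q X Y) = 0"
    using XY T_mixed[OF XY] by (simp add: H_add)
  moreover have "F (C X Y) = H (Q X Y)"
    using F XY cartan_tensor_eq[OF C XY] unfolding almost_complex_structure_def by simp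
  ultimately show ?thesis by (simp add: eq_neg_iff_add_eq_0)
qed

end

theorem lemma4p10:
  fixes M :: "'m topology"
    and A :: "('m, real^'n) chart set"
    and E :: "('m, 'n::finite) tm \<Rightarrow> real"
    and S :: "('m, 'n) tm_field"
    and F :: "('m, 'n) tm_field \<Rightarrow> ('m, 'n) tm_field"
    and \<C> :: "('m, 'n) tm_field \<Rightarrow> ('m, 'n) tm_field \<Rightarrow> ('m, 'n) tm_field"
    and D :: "('m, 'n) tm_field \<Rightarrow> ('m, 'n) tm_field \<Rightarrow> ('m, 'n) tm_field"
  assumes "finsler_manifold M A E"
    and "canonical_spray A E S"
    and "almost_complex_structure A S F"
    and "first_cartan_tensor A E S \<C>"
    and "hashiguchi_connection A E S D"
  shows "\<forall>\<zeta>\<in>VF A. \<forall>\<xi>\<in>VF A.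
           torsion (slit_atlas A) D (hproj A S \<zeta>) (hproj A S \<xi>) = curvature A S \<zeta> \<xi> \<and>
           torsion (slit_atlas A) D (hproj A S \<zeta>) (J \<xi>) = - F (\<C> \<zeta> \<xi>)"
proof -
  have "smooth_atlas A"
    using assms(1) by (auto simp: finsler_manifold_def intro: smooth_atlas_manifold)
  then interpret slit_manifold A
    by (rule slit_manifold.intro)
  interpret hashiguchi A E S D
    using assms(1,2,5) by unfold_locales (simp_all add: finsler_manifold_def)
  show ?thesis
    using T_horizontal T_mixed_eq[OF assms(4,3)] by blast
qed

end
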